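(* Let $y\sim\mathcal N(\beta_0,\sigma^2 I)$ in $\mathbb R^n$ and let $\Delta\in\mathbb R^{r\times n}$ be a linear operator. Let $q=\mathrm{rank}(\Delta)$, let $\xi_1\le\dots\le\xi_q$ denote the (nonzero) singular values of $\Delta$ in increasing order, and let $u_1,\dots,u_q$ be the corresponding left singular vectors. Assume that these vectors are incoherent: $$\|u_i\|_\infty\le \mu/\sqrt n,\qquad i=1,\dots,q,$$ for some constant $\mu\ge 1$. For $i_0\in\{1,\dots,q\}$, let $$\lambda=\Theta\left(\mu\sqrt{\frac{\log r}{n}\sum_{i=i_0+1}^q\frac1{\xi_i^2}}\,\right).$$ Then the generalized lasso estimate $$\hat\beta=\operatorname*{argmin}_{\beta\in\mathbb R^n}\ \tfrac12\|y-\beta\|_2^2+\lambda\|\Delta\beta\|_1$$ has average squared error $$\frac{\|\hat\beta-\beta_0\|_2^2}{n}=O_{\mathbb P}\left(\frac{\mathrm{nullity}(\Delta)}{n}+\frac{i_0}{n}+\frac{\mu}{n}\sqrt{\frac{\log r}{n}\sum_{i=i_0+1}^q\frac1{\xi_i^2}}\cdot\|\Delta\beta_0\|_1\right).$$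
   Context: Asymptotics are as $n\to\infty$; $\sigma>0$ is a fixed constant, while $\Delta$, its number of rows $r$, the mean vector $\beta_0\in\mathbb R^n$, $q$, $i_0$ and $\lambda\ge 0$ may depend on $n$. Left singular vectors are normalized to unit $\ell_2$ norm and form an orthonormal system. $\mathrm{nullity}(\Delta)$ is the dimension of the null space of $\Delta$. $X_n=O_{\mathbb P}(a_n)$ means that $X_n/a_n$ is bounded in probability. A statement made "with $\lambda=\Theta(a_n)$" means that the conclusion holds when the deterministic tuning parameter $\lambda$ is taken to be of exact order $a_n$, with a suitable choice of constant not depending on $n$. *)

theory Defs
  imports
    "HOL-Probability.Probability"
    "HOL-Library.Landau_Symbols"
    "Jordan_Normal_Form.Matrix_Kernel"
    "Jordan_Normal_Form.DL_Rank"
begin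

(* \<open>$\<close> and \<open>\<bullet>\<close> denote the operations on vectors of Jordan_Normal_Form, whose dimension is a value;
   here it has to grow along a sequence. *)
unbundle no vec_syntax and no inner_syntax

definition l2_norm :: "real Matrix.vec \<Rightarrow> real" where
  "l2_norm v = sqrt (v \<bullet> v)"

definition l1_norm :: "real Matrix.vec \<Rightarrow> real" where
  "l1_norm v = (\<Sum>j<dim_vec v. \<bar>v $ j\<bar>)"

(* Meaningful for vectors of positive dimension only. *)
definition linf_norm :: "real Matrix.vec \<Rightarrow> real" where
  "linf_norm v = Max ((\<lambda>j. \<bar>v $ j\<bar>) ` {..<dim_vec v})"

definition mat_rank :: "real mat \<Rightarrow> nat" where
  "mat_rank A = vec_space.rank (dim_row A) A"

definition orthonormal_system :: "nat \<Rightarrow> nat set \<Rightarrow> (nat \<Rightarrow> real Matrix.vec) \<Rightarrow> bool" where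
  "orthonormal_system d I u \<longleftrightarrow>
     (\<forall>i\<in>I. u i \<in> carrier_vec d) \<and>
     (\<forall>i\<in>I. \<forall>j\<in>I. u i \<bullet> u j = (if i = j then 1 else 0))"

(* Compact singular value decomposition A = U diag(xi) V^T with q = rank A terms, indexed by 1..q:
   xi lists the nonzero singular values with multiplicity, in increasing order, and u, v are
   corresponding left and right singular vectors. Values at indices outside 1..q are irrelevant. *)
definition compact_svd ::
  "real mat \<Rightarrow> (nat \<Rightarrow> real Matrix.vec) \<Rightarrow> (nat \<Rightarrow> real) \<Rightarrow> (nat \<Rightarrow> real Matrix.vec) \<Rightarrow> bool" where
  "compact_svd A u \<xi> v \<longleftrightarrow>
     orthonormal_system (dim_row A) {1..mat_rank A} u \<and>
     orthonormal_system (dim_col A) {1..mat_rank A} v \<and>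
     (\<forall>i\<in>{1..mat_rank A}. 0 < \<xi> i) \<and>
     mono_on {1..mat_rank A} \<xi> \<and>
     A = mat (dim_row A) (dim_col A)
           (\<lambda>(j, k). \<Sum>i=1..mat_rank A. \<xi> i * (u i $ j) * (v i $ k))"

(* y ~ N(beta0, sigma^2 I) in R^n: independent coordinates, the i-th being N(beta0_i, sigma^2). *)
definition isotropic_gaussian ::
  "'a measure \<Rightarrow> nat \<Rightarrow> ('a \<Rightarrow> real Matrix.vec) \<Rightarrow> real Matrix.vec \<Rightarrow> real \<Rightarrow> bool" where
  "isotropic_gaussian M n y \<beta>0 \<sigma> \<longleftrightarrow>
     prob_space M \<and>
     \<beta>0 \<in> carrier_vec n \<and>
     (\<forall>\<omega>\<in>space M. y \<omega> \<in> carrier_vec n) \<and>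
     prob_space.indep_vars M (\<lambda>_. borel) (\<lambda>i \<omega>. y \<omega> $ i) {..<n} \<and>
     (\<forall>i<n. distributed M lborel (\<lambda>\<omega>. y \<omega> $ i) (normal_density (\<beta>0 $ i) \<sigma>))"

definition generalized_lasso ::
  "real mat \<Rightarrow> real \<Rightarrow> real Matrix.vec \<Rightarrow> real Matrix.vec" where
  "generalized_lasso D lam y =
     (ARG_MIN (\<lambda>\<beta>. 1/2 * (l2_norm (y - \<beta>))\<^sup>2 + lam * l1_norm (D *\<^sub>v \<beta>)) \<beta>.
        \<beta> \<in> carrier_vec (dim_col D))"

(* X n = O_P(a n): the X n are eventually random variables and X n / a n is bounded in probability.
   Multiplying out the quotient avoids the convention x / 0 = 0. *)
definition bigo_in_prob ::
  "(nat \<Rightarrow> 'a measure) \<Rightarrow> (nat \<Rightarrow> 'a \<Rightarrow> real) \<Rightarrow> (nat \<Rightarrow> real) \<Rightarrow> bool" where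
  "bigo_in_prob M X a \<longleftrightarrow>
     (\<forall>\<^sub>F n in sequentially. X n \<in> borel_measurable (M n)) \<and>
     (\<forall>\<epsilon>>0. \<exists>K. \<forall>\<^sub>F n in sequentially.
        measure (M n) {\<omega> \<in> space (M n). \<bar>X n \<omega>\<bar> > K * \<bar>a n\<bar>} \<le> \<epsilon>)"

definition incoherence_rate :: "real \<Rightarrow> real mat \<Rightarrow> (nat \<Rightarrow> real) \<Rightarrow> nat \<Rightarrow> real" where
  "incoherence_rate \<mu> A \<xi> i0 =
     \<mu> * sqrt (ln (real (dim_row A)) / real (dim_col A) * (\<Sum>i=i0+1..mat_rank A. 1 / (\<xi> i)\<^sup>2))"

end

theory Submission
  imports Defs
begin

text \<open>
  Write \<open>y = \<beta>\<^sub>0 + \<epsilon>\<close> and split \<open>\<epsilon> = p + p'\<close>, where \<open>p'\<close> is the orthogonal projection of \<open>\<epsilon>\<close> onto the right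
  singular vectors \<open>v\<^sub>i\<close> with \<open>i > i\<^sub>0\<close>. Minimality of the estimate gives
  \<open>\<parallel>d\<parallel>\<^sup>2 / 2 \<le> \<langle>\<epsilon>, d\<rangle> + \<lambda> \<parallel>\<Delta> \<beta>\<^sub>0\<parallel>\<^sub>1 - \<lambda> \<parallel>\<Delta> \<beta>\<parallel>\<^sub>1\<close> for the error \<open>d = \<beta> - \<beta>\<^sub>0\<close>.
  By duality \<open>\<langle>p', d\<rangle> \<le> \<tau> \<parallel>\<Delta> d\<parallel>\<^sub>1\<close>, where \<open>\<tau>\<close> is the largest of \<open>r\<close> centred Gaussians whose variances are,
  by incoherence, at most \<open>\<sigma>\<^sup>2 \<mu>\<^sup>2 / n\<close> times the sum of the \<open>1 / \<xi>\<^sub>i\<^sup>2\<close>, \<open>i > i\<^sub>0\<close>. A union bound yields \<open>\<tau> \<le> \<lambda>\<close>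
  outside an event of probability at most \<open>2 / r\<close>, which vanishes since \<open>r \<ge> n / \<mu>\<^sup>2\<close> by incoherence again.
  Outside that event
  \<open>\<parallel>d\<parallel>\<^sup>2 \<le> 4 \<parallel>p\<parallel>\<^sup>2 + 8 \<lambda> \<parallel>\<Delta> \<beta>\<^sub>0\<parallel>\<^sub>1\<close>, and \<open>\<parallel>p\<parallel>\<^sup>2\<close> has mean \<open>\<sigma>\<^sup>2 (nullity \<Delta> + i\<^sub>0)\<close>.

  The estimate is a random variable because it is a Lipschitz function of \<open>y\<close>, as the minimized
  objective is strongly convex.
\<close>

subsection \<open>Rank and nullity\<close>

text \<open>Rank-nullity for multiplication by \<open>A\<close>: its image is the span of the
  columns, its kernel is \<open>mat_kernel A\<close>. It later converts the number of noise
  directions that are not projected out into nullity plus \<open>i0\<close>.\<close>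

lemma kernel_dim_plus_rank:
  assumes A: "A \<in> carrier_mat r n"
  shows "kernel_dim A + mat_rank A = n"
proof -
  interpret K: kernel r n A by unfold_locales (rule A)
  interpret R: vec_space "TYPE(real)" r .
  let ?V = "module_vec TYPE(real) n" and ?W = "module_vec TYPE(real) r"
  interpret L: linear_map class_ring ?V ?W "\<lambda>x. A *\<^sub>v x"
    apply unfold_locales
    apply (auto simp: module_hom_def module_vec_simps mult_add_distrib_mat_vec[OF A] mult_mat_vec[OF A])
    using A apply auto
    done
  have im: "L.imT = R.span (set (cols A))"
    unfolding R.col_space_eq[OF A, unfolded R.col_space_def] L.im_def module_vec_simps
    using mult_mat_vec_carrier[OF A] carrier_matD[OF A] by blast
  have ker: "L.kerT = mat_kernel A"
    unfolding L.ker_def mat_kernel[OF A] by (auto simp: module_vec_simps)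
  have "vectorspace.dim class_ring (?W\<lparr>carrier := L.imT\<rparr>) +
      vectorspace.dim class_ring (?V\<lparr>carrier := L.kerT\<rparr>) = K.NC.dim"
    using L.rank_nullity_main(1) K.NC.fin_dim by simp
  moreover have "K.NC.dim = n" by (simp add: K.NC.dim_is_n)
  ultimately show ?thesis
    unfolding im ker K.kernel_dim mat_rank_def R.rank_def using A
    by (simp add: R.rank_def)
qed

subsection \<open>Deterministic error bound\<close>

text \<open>Parseval: after expanding the square, orthonormality leaves only the diagonal
  terms.\<close>

lemma orthonormal_combination_square_sum:
  fixes v :: "nat \<Rightarrow> nat \<Rightarrow> real"
  assumes fin: "finite I"
    and orth: "\<And>i i'. i \<in> I \<Longrightarrow> i' \<in> I \<Longrightarrow> (\<Sum>k<n. v i k * v i' k) = (if i = i' then 1 else 0)"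
  shows "(\<Sum>k<n. (\<Sum>i\<in>I. w i * v i k)\<^sup>2) = (\<Sum>i\<in>I. (w i)\<^sup>2)"
proof -
  have "(\<Sum>k<n. (\<Sum>i\<in>I. w i * v i k)\<^sup>2) = (\<Sum>k<n. \<Sum>i\<in>I. \<Sum>i'\<in>I. (w i * w i') * (v i k * v i' k))"
    by (simp add: power2_eq_square sum_product mult_ac)
  also have "\<dots> = (\<Sum>i\<in>I. \<Sum>i'\<in>I. \<Sum>k<n. (w i * w i') * (v i k * v i' k))"
    by (subst sum.swap, rule sum.cong[OF refl], rule sum.swap)
  also have "\<dots> = (\<Sum>i\<in>I. \<Sum>i'\<in>I. (w i * w i') * (if i = i' then 1 else 0))"
    using orth by (auto intro!: sum.cong simp flip: sum_distrib_left)
  also have "\<dots> = (\<Sum>i\<in>I. (w i)\<^sup>2)"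
    using fin by (simp add: power2_eq_square if_distrib cong: if_cong)
  finally show ?thesis .
qed

text \<open>Pythagoras: the inner product of \<open>e\<close> with its projection equals the squared
  norm of the projection. The difference form reduces the moments of the residual to those of linear
  forms in \<open>e\<close>.\<close>

lemma orthonormal_residual_square_sum:
  fixes v :: "nat \<Rightarrow> nat \<Rightarrow> real"
  assumes fin: "finite I"
    and orth: "\<And>i i'. i \<in> I \<Longrightarrow> i' \<in> I \<Longrightarrow> (\<Sum>k<n. v i k * v i' k) = (if i = i' then 1 else 0)"
  shows "(\<Sum>k<n. (e k - (\<Sum>i\<in>I. (\<Sum>l<n. v i l * e l) * v i k))\<^sup>2)
    = (\<Sum>k<n. (e k)\<^sup>2) - (\<Sum>i\<in>I. (\<Sum>k<n. v i k * e k)\<^sup>2)"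
proof -
  let ?w = "\<lambda>i. \<Sum>l<n. v i l * e l"
  have cross: "(\<Sum>k<n. e k * (\<Sum>i\<in>I. ?w i * v i k)) = (\<Sum>i\<in>I. (?w i)\<^sup>2)"
  proof -
    have "(\<Sum>k<n. e k * (\<Sum>i\<in>I. ?w i * v i k)) = (\<Sum>k<n. \<Sum>i\<in>I. ?w i * (v i k * e k))"
      by (simp add: sum_distrib_left mult_ac)
    also have "\<dots> = (\<Sum>i\<in>I. \<Sum>k<n. ?w i * (v i k * e k))"
      by (rule sum.swap)
    also have "\<dots> = (\<Sum>i\<in>I. (?w i)\<^sup>2)"
      by (simp only: sum_distrib_left[symmetric] power2_eq_square)
    finally show ?thesis .
  qed
  have "(\<Sum>k<n. (e k - (\<Sum>i\<in>I. ?w i * v i k))\<^sup>2) = (\<Sum>k<n. (e k)\<^sup>2)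
      - 2 * (\<Sum>k<n. e k * (\<Sum>i\<in>I. ?w i * v i k)) + (\<Sum>k<n. (\<Sum>i\<in>I. ?w i * v i k)\<^sup>2)"
    by (simp add: power2_diff sum.distrib sum_subtractf sum_distrib_left mult.assoc)
  moreover have "(\<Sum>k<n. (\<Sum>i\<in>I. ?w i * v i k)\<^sup>2) = (\<Sum>i\<in>I. (?w i)\<^sup>2)"
    by (rule orthonormal_combination_square_sum[OF fin orth])
  ultimately show ?thesis
    unfolding cross by simp
qed

text \<open>The part of the noise along the singular directions in \<open>I\<close> acts on \<open>d\<close> only through
  \<open>D d\<close>, because \<open>\<langle>v\<^sub>i, d\<rangle> = \<langle>u\<^sub>i, D d\<rangle> / \<xi>\<^sub>i\<close>; Hoelder's inequality then applies.\<close>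

lemma noise_split:
  fixes u v :: "nat \<Rightarrow> nat \<Rightarrow> real" and Dd :: "nat \<Rightarrow> real"
  assumes adj: "\<And>i. i \<in> I \<Longrightarrow> (\<Sum>k<n. v i k * d k) = (\<Sum>j<r. u i j * Dd j) / \<xi> i"
    and sup: "\<And>j. j < r \<Longrightarrow> \<bar>\<Sum>k<n. (\<Sum>i\<in>I. u i j / \<xi> i * v i k) * e k\<bar> \<le> \<tau>"
  shows "(\<Sum>k<n. e k * d k)
    \<le> (\<Sum>k<n. (e k - (\<Sum>i\<in>I. (\<Sum>l<n. v i l * e l) * v i k)) * d k) + \<tau> * (\<Sum>j<r. \<bar>Dd j\<bar>)"
proof -
  let ?w = "\<lambda>i. \<Sum>l<n. v i l * e l"
  have "(\<Sum>k<n. (\<Sum>i\<in>I. ?w i * v i k) * d k) = (\<Sum>k<n. \<Sum>i\<in>I. ?w i * (v i k * d k))"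
    by (intro sum.cong refl) (subst sum_distrib_right, simp only: mult.assoc)
  also have "\<dots> = (\<Sum>i\<in>I. \<Sum>k<n. ?w i * (v i k * d k))" by (rule sum.swap)
  also have "\<dots> = (\<Sum>i\<in>I. ?w i * (\<Sum>k<n. v i k * d k))" by (simp only: sum_distrib_left)
  also have "\<dots> = (\<Sum>i\<in>I. \<Sum>j<r. ?w i * (u i j / \<xi> i) * Dd j)"
    using adj by (simp add: sum_distrib_left sum_divide_distrib mult_ac)
  \<comment> \<open>Regrouping by \<open>j\<close> turns the coefficient of \<open>Dd j\<close> into
    the linear form in the noise that \<open>sup\<close> controls.\<close>
  also have "\<dots> = (\<Sum>j<r. (\<Sum>i\<in>I. ?w i * (u i j / \<xi> i)) * Dd j)"
    by (subst sum.swap) (simp only: sum_distrib_right)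
  also have "\<dots> = (\<Sum>j<r. (\<Sum>k<n. (\<Sum>i\<in>I. u i j / \<xi> i * v i k) * e k) * Dd j)"
  proof -
    have "(\<Sum>i\<in>I. ?w i * (u i j / \<xi> i)) = (\<Sum>k<n. (\<Sum>i\<in>I. u i j / \<xi> i * v i k) * e k)" for j
    proof -
      have "(\<Sum>i\<in>I. ?w i * (u i j / \<xi> i)) = (\<Sum>i\<in>I. \<Sum>k<n. u i j / \<xi> i * v i k * e k)"
        by (intro sum.cong refl) (subst sum_distrib_right, simp add: mult_ac)
      also have "\<dots> = (\<Sum>k<n. (\<Sum>i\<in>I. u i j / \<xi> i * v i k) * e k)"
        by (subst sum.swap) (simp only: sum_distrib_right)
      finally show ?thesis .
    qed
    then show ?thesis by simp
  qed
  also have "\<dots> \<le> (\<Sum>j<r. \<tau> * \<bar>Dd j\<bar>)"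
  proof (rule sum_mono)
    fix j assume "j \<in> {..<r}"
    then have "\<bar>\<Sum>k<n. (\<Sum>i\<in>I. u i j / \<xi> i * v i k) * e k\<bar> * \<bar>Dd j\<bar> \<le> \<tau> * \<bar>Dd j\<bar>"
      using sup by (intro mult_right_mono) auto
    then show "(\<Sum>k<n. (\<Sum>i\<in>I. u i j / \<xi> i * v i k) * e k) * Dd j \<le> \<tau> * \<bar>Dd j\<bar>"
      unfolding abs_mult[symmetric] by (rule order_trans[OF abs_ge_self])
  qed
  finally show ?thesis
    by (simp add: left_diff_distrib sum_subtractf sum_distrib_left)
qed

text \<open>The noise costs at most \<open>lam * (A + B)\<close> through \<open>D d\<close>; the
  \<open>lam * A\<close> in this cost cancels against the penalty of \<open>b\<close>, so only
  \<open>2 * lam * B\<close> survives, a term in \<open>b0\<close> alone.\<close>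

lemma basic_inequality:
  fixes u v :: "nat \<Rightarrow> nat \<Rightarrow> real" and Db Db0 :: "nat \<Rightarrow> real"
  assumes opt: "(\<Sum>k<n. (y k - b k)\<^sup>2) / 2 + lam * (\<Sum>j<r. \<bar>Db j\<bar>)
      \<le> (\<Sum>k<n. (y k - b0 k)\<^sup>2) / 2 + lam * (\<Sum>j<r. \<bar>Db0 j\<bar>)"
    and adj: "\<And>i. i \<in> I \<Longrightarrow> (\<Sum>k<n. v i k * (b k - b0 k)) = (\<Sum>j<r. u i j * (Db j - Db0 j)) / \<xi> i"
    and sup: "\<And>j. j < r \<Longrightarrow> \<bar>\<Sum>k<n. (\<Sum>i\<in>I. u i j / \<xi> i * v i k) * (y k - b0 k)\<bar> \<le> lam"
    and lam: "lam \<ge> 0"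
  shows "(\<Sum>k<n. (b k - b0 k)\<^sup>2)
    \<le> 4 * (\<Sum>k<n. (y k - b0 k - (\<Sum>i\<in>I. (\<Sum>l<n. v i l * (y l - b0 l)) * v i k))\<^sup>2)
      + 8 * lam * (\<Sum>j<r. \<bar>Db0 j\<bar>)"
proof -
  let ?e = "\<lambda>k. y k - b0 k" and ?d = "\<lambda>k. b k - b0 k"
  let ?p = "\<lambda>k. ?e k - (\<Sum>i\<in>I. (\<Sum>l<n. v i l * ?e l) * v i k)"
  define X where "X = (\<Sum>k<n. (?d k)\<^sup>2)"
  define P where "P = (\<Sum>k<n. (?p k)\<^sup>2)"
  define A where "A = (\<Sum>j<r. \<bar>Db j\<bar>)"
  define B where "B = (\<Sum>j<r. \<bar>Db0 j\<bar>)"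
  define C where "C = (\<Sum>k<n. ?e k * ?d k)"
  define N where "N = (\<Sum>k<n. (y k - b k)\<^sup>2)"
  define N0 where "N0 = (\<Sum>k<n. (y k - b0 k)\<^sup>2)"
  have "N = N0 - 2 * C + X"
    unfolding N_def N0_def C_def X_def sum_distrib_left sum.distrib[symmetric] sum_subtractf[symmetric]
    by (intro sum.cong refl) (simp add: field_simps power2_eq_square)
  moreover have "N / 2 + lam * A \<le> N0 / 2 + lam * B"
    using opt by (simp only: N_def N0_def A_def B_def)
  ultimately have 1: "X / 2 + lam * A \<le> C + lam * B"
    by argo
  have 2: "C \<le> (\<Sum>k<n. ?p k * ?d k) + lam * (\<Sum>j<r. \<bar>Db j - Db0 j\<bar>)"
    unfolding C_def by (rule noise_split[OF adj sup])
  have "(\<Sum>j<r. \<bar>Db j - Db0 j\<bar>) \<le> A + B"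
    unfolding A_def B_def sum.distrib[symmetric] by (intro sum_mono) auto
  then have 3: "lam * (\<Sum>j<r. \<bar>Db j - Db0 j\<bar>) \<le> lam * A + lam * B"
    using mult_left_mono[OF _ lam] by (fastforce simp: distrib_left)
  \<comment> \<open>Young's inequality, weighted so that \<open>X / 4\<close> is absorbed by
    \<open>X / 2\<close>. Multiplying the remaining \<open>X / 4\<close> by 4 gives the constants 4
    and 8.\<close>
  have "(\<Sum>k<n. ?p k * ?d k) \<le> (\<Sum>k<n. (?p k)\<^sup>2 + (?d k)\<^sup>2 / 4)"
  proof (rule sum_mono)
    fix k
    have "p * d \<le> p\<^sup>2 + d\<^sup>2 / 4" for p d :: real
      using zero_le_power2[of "p - d / 2"] by (simp add: field_simps power2_eq_square)
    then show "?p k * ?d k \<le> (?p k)\<^sup>2 + (?d k)\<^sup>2 / 4" .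
  qed
  also have "\<dots> = P + X / 4"
    by (simp add: P_def X_def sum.distrib sum_divide_distrib)
  finally have "X \<le> 4 * P + 8 * (lam * B)"
    using 1 2 3 by linarith
  then show ?thesis by (simp add: X_def P_def B_def)
qed

subsection \<open>Linear forms in Gaussian noise\<close>

text \<open>Completing the square: exponential tilting shifts the mean of a Gaussian. Since the
  shifted density has integral 1, the prefactor is the moment generating function.\<close>

lemma normal_density_times_exp:
  assumes "s > 0"
  shows "normal_density 0 s x * exp (\<theta> * x) = exp (\<theta>\<^sup>2 * s\<^sup>2 / 2) * normal_density (\<theta> * s\<^sup>2) s x"
proof -
  have "- x\<^sup>2 / (2 * s\<^sup>2) + \<theta> * x = \<theta>\<^sup>2 * s\<^sup>2 / 2 + - (x - \<theta> * s\<^sup>2)\<^sup>2 / (2 * s\<^sup>2)"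
    using assms by (simp add: field_simps power2_eq_square)
  then have "exp (- x\<^sup>2 / (2 * s\<^sup>2)) * exp (\<theta> * x)
      = exp (\<theta>\<^sup>2 * s\<^sup>2 / 2) * exp (- (x - \<theta> * s\<^sup>2)\<^sup>2 / (2 * s\<^sup>2))"
    by (simp only: exp_add[symmetric])
  then show ?thesis
    by (simp add: normal_density_def)
qed

lemma (in prob_space) normal_upper_tail:
  assumes X: "distributed M lborel X (normal_density 0 s)" and s: "s > 0" and \<tau>: "\<tau> \<ge> 0"
  shows "prob {\<omega> \<in> space M. \<tau> \<le> X \<omega>} \<le> exp (- \<tau>\<^sup>2 / (2 * s\<^sup>2))"
proof -
  \<comment> \<open>The Chernoff parameter that minimizes the exponent
    \<open>\<theta>\<^sup>2 * s\<^sup>2 / 2 - \<theta> * \<tau>\<close>.\<close>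
  define \<theta> where "\<theta> = \<tau> / s\<^sup>2"
  have th: "\<theta> \<ge> 0" using \<tau> by (simp add: \<theta>_def)
  have [measurable]: "X \<in> borel_measurable M"
    using distributed_measurable[OF X] by simp
  have I: "integrable M (\<lambda>\<omega>. exp (\<theta> * X \<omega>))"
    by (subst distributed_integrable[OF X, symmetric])
       (auto simp: normal_density_times_exp[OF s] s)
  have E: "(\<integral>\<omega>. exp (\<theta> * X \<omega>) \<partial>M) = exp (\<theta>\<^sup>2 * s\<^sup>2 / 2)"
    by (subst distributed_integral[OF X, symmetric])
       (auto simp: normal_density_times_exp[OF s] s)
  have "prob {\<omega> \<in> space M. \<tau> \<le> X \<omega>} \<le> prob {\<omega> \<in> space M. exp (\<theta> * \<tau>) \<le> exp (\<theta> * X \<omega>)}"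
    using th by (intro finite_measure_mono) (auto intro: mult_left_mono)
  also have "\<dots> \<le> (\<integral>\<omega>. exp (\<theta> * X \<omega>) \<partial>M) / exp (\<theta> * \<tau>)"
    by (rule integral_Markov_inequality_measure[where A="{}"]) (use I in auto)
  also have "\<dots> = exp (\<theta>\<^sup>2 * s\<^sup>2 / 2 - \<theta> * \<tau>)"
    unfolding E by (simp add: exp_diff)
  also have "\<theta>\<^sup>2 * s\<^sup>2 / 2 - \<theta> * \<tau> = - \<tau>\<^sup>2 / (2 * s\<^sup>2)"
    using s by (simp add: \<theta>_def field_simps power2_eq_square)
  finally show ?thesis .
qed

locale gaussian_noise = prob_space M for M :: "'a measure" +
  fixes n :: nat and \<sigma> :: real and e :: "nat \<Rightarrow> 'a \<Rightarrow> real"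
  assumes sigma_pos: "\<sigma> > 0"
    and indep: "indep_vars (\<lambda>_. borel) e {..<n}"
    and normal: "k < n \<Longrightarrow> distributed M lborel (e k) (normal_density 0 \<sigma>)"
begin

lemma noise_measurable: "k < n \<Longrightarrow> e k \<in> borel_measurable M"
  using distributed_measurable[OF normal] by simp

lemma linear_form_measurable [measurable]: "(\<lambda>\<omega>. \<Sum>k<n. a k * e k \<omega>) \<in> borel_measurable M"
  using noise_measurable by (intro borel_measurable_sum) auto

lemma linear_form_normal:
  assumes pos: "(\<Sum>k<n. (a k)\<^sup>2) > 0"
  shows "distributed M lborel (\<lambda>\<omega>. \<Sum>k<n. a k * e k \<omega>) (normal_density 0 (\<sigma> * sqrt (\<Sum>k<n. (a k)\<^sup>2)))"
proof -
  \<comment> \<open>Terms with coefficient 0 have no normal density, whereas the theorem on sums of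
    independent normals requires positive deviations; hence the restriction to the support of
    \<open>a\<close>.\<close>
  define I where "I = {k. k < n \<and> a k \<noteq> 0}"
  have fin: "finite I" and sub: "I \<subseteq> {..<n}" by (auto simp: I_def)
  have ne: "I \<noteq> {}"
  proof
    assume "I = {}"
    then have "(\<Sum>k<n. (a k)\<^sup>2) = 0" by (intro sum.neutral) (auto simp: I_def)
    with pos show False by simp
  qed
  have "indep_vars (\<lambda>_. borel) (\<lambda>k \<omega>. a k * e k \<omega>) {..<n}"
    using indep_vars_compose2[OF indep, where Y="\<lambda>k x. a k * x" and N="\<lambda>_. borel"] by simp
  then have ind: "indep_vars (\<lambda>_. borel) (\<lambda>k \<omega>. a k * e k \<omega>) I"
    by (rule indep_vars_subset[OF _ sub])
  have "distributed M lborel (\<lambda>\<omega>. \<Sum>k\<in>I. a k * e k \<omega>)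
      (normal_density (\<Sum>k\<in>I. 0) (sqrt (\<Sum>k\<in>I. (\<bar>a k\<bar> * \<sigma>)\<^sup>2)))"
  proof (rule sum_indep_normal[OF fin ne ind])
    fix k assume "k \<in> I"
    then have k: "k < n" "a k \<noteq> 0" by (auto simp: I_def)
    then show "0 < \<bar>a k\<bar> * \<sigma>" using sigma_pos by simp
    show "distributed M lborel (\<lambda>\<omega>. a k * e k \<omega>) (normal_density 0 (\<bar>a k\<bar> * \<sigma>))"
      using normal_density_affine[OF normal[OF k(1)] sigma_pos k(2), of 0] by simp
  qed
  moreover have "(\<Sum>k\<in>I. a k * e k \<omega>) = (\<Sum>k<n. a k * e k \<omega>)" for \<omega>
    by (rule sum.mono_neutral_left) (auto simp: I_def)
  moreover have "(\<Sum>k\<in>I. (\<bar>a k\<bar> * \<sigma>)\<^sup>2) = (\<Sum>k<n. (a k)\<^sup>2) * \<sigma>\<^sup>2"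
    unfolding sum_distrib_right
    by (rule sum.mono_neutral_cong_left) (auto simp: I_def power_mult_distrib)
  ultimately show ?thesis
    using sigma_pos by (simp add: real_sqrt_mult mult.commute)
qed

lemma linear_form_second_moment:
  shows "integrable M (\<lambda>\<omega>. (\<Sum>k<n. a k * e k \<omega>)\<^sup>2)"
    and "expectation (\<lambda>\<omega>. (\<Sum>k<n. a k * e k \<omega>)\<^sup>2) = \<sigma>\<^sup>2 * (\<Sum>k<n. (a k)\<^sup>2)"
proof -
  let ?Z = "\<lambda>\<omega>. \<Sum>k<n. a k * e k \<omega>"
  have "integrable M (\<lambda>\<omega>. (?Z \<omega>)\<^sup>2) \<and> expectation (\<lambda>\<omega>. (?Z \<omega>)\<^sup>2) = \<sigma>\<^sup>2 * (\<Sum>k<n. (a k)\<^sup>2)"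
  \<comment> \<open>The form with all coefficients 0 is constant and has no normal density, so it is
    treated apart.\<close>
  proof (cases "(\<Sum>k<n. (a k)\<^sup>2) = 0")
    case True
    then have "\<And>k. k < n \<Longrightarrow> a k = 0"
      by (subst (asm) sum_nonneg_eq_0_iff) auto
    then have "?Z \<omega> = 0" for \<omega>
      by (intro sum.neutral) auto
    with True show ?thesis by simp
  next
    case False
    define s where "s = \<sigma> * sqrt (\<Sum>k<n. (a k)\<^sup>2)"
    have pos: "(\<Sum>k<n. (a k)\<^sup>2) > 0"
      using False sum_nonneg[of "{..<n}" "\<lambda>k. (a k)\<^sup>2"] by (simp add: less_le)
    then have s: "s > 0" using sigma_pos by (simp add: s_def)
    have D: "distributed M lborel ?Z (normal_density 0 s)"
      unfolding s_def by (rule linear_form_normal[OF pos])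
    have "integrable M (\<lambda>\<omega>. (?Z \<omega>)\<^sup>2)"
      by (subst distributed_integrable[OF D, symmetric])
         (use integrable_normal_moment[OF s, of 0 2] in auto)
    moreover have "expectation (\<lambda>\<omega>. (?Z \<omega>)\<^sup>2) = s\<^sup>2"
      using normal_distributed_variance[OF s D] normal_distributed_expectation[OF s D] by simp
    ultimately show ?thesis
      using pos by (simp add: s_def power_mult_distrib)
  qed
  then show "integrable M (\<lambda>\<omega>. (?Z \<omega>)\<^sup>2)"
    and "expectation (\<lambda>\<omega>. (?Z \<omega>)\<^sup>2) = \<sigma>\<^sup>2 * (\<Sum>k<n. (a k)\<^sup>2)" by auto
qed

lemma noise_second_moment:
  assumes "k < n"
  shows "integrable M (\<lambda>\<omega>. (e k \<omega>)\<^sup>2)" and "expectation (\<lambda>\<omega>. (e k \<omega>)\<^sup>2) = \<sigma>\<^sup>2"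
  using assms linear_form_second_moment[of "\<lambda>l. if l = k then 1 else 0"]
  by (simp_all add: if_distrib[where f="\<lambda>x. x * _"] if_distrib[where f="\<lambda>x. x ^ 2"] cong: if_cong)

text \<open>By Pythagoras the residual is a difference of squared linear forms: the \<open>n\<close>
  coordinates and the \<open>card I\<close> unit directions each contribute
  \<open>\<sigma>\<^sup>2\<close>.\<close>

lemma residual_second_moment:
  fixes v :: "nat \<Rightarrow> nat \<Rightarrow> real"
  assumes fin: "finite I"
    and orth: "\<And>i i'. i \<in> I \<Longrightarrow> i' \<in> I \<Longrightarrow> (\<Sum>k<n. v i k * v i' k) = (if i = i' then 1 else 0)"
  defines "R \<equiv> \<lambda>\<omega>. \<Sum>k<n. (e k \<omega> - (\<Sum>i\<in>I. (\<Sum>l<n. v i l * e l \<omega>) * v i k))\<^sup>2"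
  shows "integrable M R" and "expectation R = \<sigma>\<^sup>2 * (real n - real (card I))"
proof -
  have R: "R = (\<lambda>\<omega>. (\<Sum>k<n. (e k \<omega>)\<^sup>2) - (\<Sum>i\<in>I. (\<Sum>k<n. v i k * e k \<omega>)\<^sup>2))"
    unfolding R_def by (intro ext orthonormal_residual_square_sum[OF fin orth])
  have 1: "integrable M (\<lambda>\<omega>. \<Sum>k<n. (e k \<omega>)\<^sup>2)"
    using noise_second_moment(1) by (intro Bochner_Integration.integrable_sum) auto
  have 2: "integrable M (\<lambda>\<omega>. \<Sum>i\<in>I. (\<Sum>k<n. v i k * e k \<omega>)\<^sup>2)"
    by (intro Bochner_Integration.integrable_sum linear_form_second_moment(1))
  show "integrable M R"
    unfolding R using 1 2 by (rule Bochner_Integration.integrable_diff)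
  have "expectation (\<lambda>\<omega>. \<Sum>k<n. (e k \<omega>)\<^sup>2) = \<sigma>\<^sup>2 * real n"
    using noise_second_moment by (subst Bochner_Integration.integral_sum) auto
  moreover have "expectation (\<lambda>\<omega>. \<Sum>i\<in>I. (\<Sum>k<n. v i k * e k \<omega>)\<^sup>2) = (\<Sum>i\<in>I. \<sigma>\<^sup>2)"
  proof (subst Bochner_Integration.integral_sum)
    fix i assume "i \<in> I"
    then show "integrable M (\<lambda>\<omega>. (\<Sum>k<n. v i k * e k \<omega>)\<^sup>2)"
      by (intro linear_form_second_moment(1))
  next
    have "(\<Sum>k<n. (v i k)\<^sup>2) = 1" if "i \<in> I" for i
      using orth[OF that that] by (simp add: power2_eq_square)
    then show "(\<Sum>i\<in>I. expectation (\<lambda>\<omega>. (\<Sum>k<n. v i k * e k \<omega>)\<^sup>2)) = (\<Sum>i\<in>I. \<sigma>\<^sup>2)"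
      by (simp add: linear_form_second_moment(2))
  qed
  ultimately show "expectation R = \<sigma>\<^sup>2 * (real n - real (card I))"
    unfolding R Bochner_Integration.integral_diff[OF 1 2] by (simp add: right_diff_distrib mult.commute)
qed

text \<open>The Gaussian tail bound grows with the variance, so an upper bound
  \<open>s\<^sup>2\<close> on the variance suffices. This lets one \<open>s\<close> serve a whole
  family of forms.\<close>

lemma linear_form_upper_tail:
  assumes le: "\<sigma>\<^sup>2 * (\<Sum>k<n. (a k)\<^sup>2) \<le> s\<^sup>2" and \<tau>: "\<tau> \<ge> 0"
  shows "prob {\<omega> \<in> space M. \<tau> < (\<Sum>k<n. a k * e k \<omega>)} \<le> exp (- \<tau>\<^sup>2 / (2 * s\<^sup>2))"
\<comment> \<open>For the zero form the strict inequality makes the event empty, even when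
  \<open>\<tau>\<close> is 0.\<close>
proof (cases "(\<Sum>k<n. (a k)\<^sup>2) = 0")
  case True
  then have "\<And>k. k < n \<Longrightarrow> a k = 0"
    by (subst (asm) sum_nonneg_eq_0_iff) auto
  then have "(\<Sum>k<n. a k * e k \<omega>) = 0" for \<omega>
    by (intro sum.neutral) auto
  with \<tau> show ?thesis by simp
next
  case False
  define s0 where "s0 = \<sigma> * sqrt (\<Sum>k<n. (a k)\<^sup>2)"
  have pos: "(\<Sum>k<n. (a k)\<^sup>2) > 0"
    using False sum_nonneg[of "{..<n}" "\<lambda>k. (a k)\<^sup>2"] by (simp add: less_le)
  then have s0: "s0 > 0" using sigma_pos by (simp add: s0_def)
  have sq: "s0\<^sup>2 \<le> s\<^sup>2" using pos le by (simp add: s0_def power_mult_distrib)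
  have "prob {\<omega> \<in> space M. \<tau> < (\<Sum>k<n. a k * e k \<omega>)} \<le> prob {\<omega> \<in> space M. \<tau> \<le> (\<Sum>k<n. a k * e k \<omega>)}"
    by (intro finite_measure_mono) auto
  also have "\<dots> \<le> exp (- \<tau>\<^sup>2 / (2 * s0\<^sup>2))"
    using linear_form_normal[OF pos, folded s0_def] s0 \<tau> by (rule normal_upper_tail)
  also have "\<dots> \<le> exp (- \<tau>\<^sup>2 / (2 * s\<^sup>2))"
    using sq s0 by (auto intro!: divide_left_mono mult_pos_pos order_less_le_trans[OF _ sq])
  finally show ?thesis .
qed

lemma linear_form_tail:
  assumes le: "\<sigma>\<^sup>2 * (\<Sum>k<n. (a k)\<^sup>2) \<le> s\<^sup>2" and \<tau>: "\<tau> \<ge> 0"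
  shows "prob {\<omega> \<in> space M. \<tau> < \<bar>\<Sum>k<n. a k * e k \<omega>\<bar>} \<le> 2 * exp (- \<tau>\<^sup>2 / (2 * s\<^sup>2))"
proof -
  let ?Z = "\<lambda>\<omega>. \<Sum>k<n. a k * e k \<omega>" and ?N = "\<lambda>\<omega>. - (\<Sum>k<n. a k * e k \<omega>)"
  have "prob {\<omega> \<in> space M. \<tau> < \<bar>?Z \<omega>\<bar>}
      \<le> prob ({\<omega> \<in> space M. \<tau> < ?Z \<omega>} \<union> {\<omega> \<in> space M. \<tau> < ?N \<omega>})"
    by (intro finite_measure_mono) (auto simp: abs_if split: if_splits)
  also have "\<dots> \<le> prob {\<omega> \<in> space M. \<tau> < ?Z \<omega>} + prob {\<omega> \<in> space M. \<tau> < ?N \<omega>}"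
    by (intro measure_Un_le) auto
  also have "\<dots> \<le> exp (- \<tau>\<^sup>2 / (2 * s\<^sup>2)) + exp (- \<tau>\<^sup>2 / (2 * s\<^sup>2))"
    using linear_form_upper_tail[OF le \<tau>] linear_form_upper_tail[of "\<lambda>k. - a k", OF _ \<tau>, of s] le
    by (intro add_mono) (auto simp: sum_negf)
  finally show ?thesis by simp
qed

lemma linear_forms_max_tail:
  assumes le: "\<And>j. j < r \<Longrightarrow> \<sigma>\<^sup>2 * (\<Sum>k<n. (a j k)\<^sup>2) \<le> s\<^sup>2" and \<tau>: "\<tau> \<ge> 0"
  shows "prob {\<omega> \<in> space M. \<exists>j<r. \<tau> < \<bar>\<Sum>k<n. a j k * e k \<omega>\<bar>} \<le> 2 * real r * exp (- \<tau>\<^sup>2 / (2 * s\<^sup>2))"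
proof -
  have "{\<omega> \<in> space M. \<exists>j<r. \<tau> < \<bar>\<Sum>k<n. a j k * e k \<omega>\<bar>}
      = (\<Union>j<r. {\<omega> \<in> space M. \<tau> < \<bar>\<Sum>k<n. a j k * e k \<omega>\<bar>})" by auto
  also have "prob \<dots> \<le> (\<Sum>j<r. prob {\<omega> \<in> space M. \<tau> < \<bar>\<Sum>k<n. a j k * e k \<omega>\<bar>})"
    by (intro finite_measure_subadditive_finite) auto
  also have "\<dots> \<le> (\<Sum>j<r. 2 * exp (- \<tau>\<^sup>2 / (2 * s\<^sup>2)))"
    using linear_form_tail[OF le \<tau>] by (intro sum_mono) auto
  finally show ?thesis by simp
qed

end

subsection \<open>Proximal maps\<close>

text \<open>Vectors are encoded as functions on all naturals, of which the quadratic part reads the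
  first \<open>n\<close> values. One type with the product topology then serves every
  dimension.\<close>

definition prox_objective :: "nat \<Rightarrow> ((nat \<Rightarrow> real) \<Rightarrow> real) \<Rightarrow> (nat \<Rightarrow> real) \<Rightarrow> (nat \<Rightarrow> real) \<Rightarrow> real" where
  "prox_objective n L z b = (\<Sum>k<n. (z k - b k)\<^sup>2) / 2 + L b"

text \<open>Since \<open>L\<close> is nonnegative, any competitor at least as good as
  \<open>z\<close> lies, in each of the first \<open>n\<close> coordinates, within \<open>R\<close>
  of \<open>z\<close>. A minimizer over that box is therefore global.\<close>

lemma prox_exists:
  assumes cont: "continuous_on UNIV L"
    and nonneg: "\<And>b. L b \<ge> 0"
    and local: "\<And>b c. (\<And>k. k < n \<Longrightarrow> b k = c k) \<Longrightarrow> L b = L c"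
  shows "\<exists>b. \<forall>c. prox_objective n L z b \<le> prox_objective n L z c"
proof -
  let ?F = "prox_objective n L z"
  define R where "R = sqrt (2 * ?F z)"
  \<comment> \<open>Pinning the coordinates from \<open>n\<close> on to 0 makes the box compact in
    the infinite product; \<open>cut\<close> moves any function to this form without changing the
    objective.\<close>
  define S where "S = (\<Pi>\<^sub>E k\<in>UNIV. if k < n then {z k - R..z k + R} else {0})"
  define cut where "cut b = (\<lambda>k. if k < n then b k else 0)" for b :: "nat \<Rightarrow> real"
  have F_cut: "?F (cut b) = ?F b" for b
    using local[of "cut b" b] by (simp add: prox_objective_def cut_def)
  have Fz: "?F z = L z" by (simp add: prox_objective_def)
  have R: "R \<ge> 0" using nonneg[of z] by (simp add: R_def Fz)
  have "compactin (product_topology (\<lambda>_. euclidean) UNIV) S"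
    unfolding S_def by (subst compactin_PiE) auto
  then have "compact S" by (simp add: euclidean_product_topology)
  moreover have "cut z \<in> S" using R by (auto simp: S_def cut_def)
  moreover have "continuous_on S ?F"
    unfolding prox_objective_def
    by (intro continuous_intros continuous_on_subset[OF cont] continuous_on_subset[OF continuous_on_product_coordinates]) auto
  ultimately obtain b where b: "b \<in> S" "\<And>c. c \<in> S \<Longrightarrow> ?F b \<le> ?F c"
    using continuous_attains_inf[of S ?F] by blast
  have "?F b \<le> ?F c" for c
  proof (cases "?F c \<le> ?F z")
    case True
    have "\<bar>c k - z k\<bar> \<le> R" if "k < n" for k
    proof -
      have "(z k - c k)\<^sup>2 \<le> (\<Sum>k<n. (z k - c k)\<^sup>2)"
        using that by (intro member_le_sum) auto
      also have "\<dots> \<le> 2 * ?F z"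
        using True nonneg[of c] by (simp add: prox_objective_def)
      finally have "sqrt ((z k - c k)\<^sup>2) \<le> R" unfolding R_def by (rule real_sqrt_le_mono)
      then show ?thesis by simp
    qed
    then have "cut c \<in> S" by (fastforce simp: S_def cut_def abs_le_iff)
    from b(2)[OF this] show ?thesis by (simp add: F_cut)
  next
    case False
    moreover have "?F b \<le> ?F z" using b(2)[OF \<open>cut z \<in> S\<close>] by (simp add: F_cut)
    ultimately show ?thesis by simp
  qed
  then show ?thesis by blast
qed

text \<open>Strong convexity at the midpoint: the parallelogram identity gains a quarter of the
  squared distance between \<open>b\<close> and \<open>c\<close>, and the value at the midpoint is
  at least the minimum.\<close>

lemma prox_growth:
  assumes convex: "\<And>b c. L (\<lambda>k. (b k + c k) / 2) \<le> (L b + L c) / 2"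
    and min: "\<And>c. prox_objective n L z b \<le> prox_objective n L z c"
  shows "prox_objective n L z b + (\<Sum>k<n. (b k - c k)\<^sup>2) / 4 \<le> prox_objective n L z c"
proof -
  let ?m = "\<lambda>k. (b k + c k) / 2"
  have "(\<Sum>k<n. (z k - ?m k)\<^sup>2) =
      (\<Sum>k<n. (z k - b k)\<^sup>2) / 2 + (\<Sum>k<n. (z k - c k)\<^sup>2) / 2 - (\<Sum>k<n. (b k - c k)\<^sup>2) / 4"
    unfolding sum_divide_distrib sum.distrib[symmetric] sum_subtractf[symmetric]
    by (intro sum.cong refl) (simp add: field_simps power2_eq_square)
  moreover have "2 * (s / 2 + t) \<le> p / 2 + x + (q / 2 + y) - d / 4"
    if "s = p / 2 + q / 2 - d / 4" "t \<le> (x + y) / 2" for s t p q d x y :: real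
    using that by argo
  ultimately have "2 * prox_objective n L z ?m
      \<le> prox_objective n L z b + prox_objective n L z c - (\<Sum>k<n. (b k - c k)\<^sup>2) / 4"
    unfolding prox_objective_def using convex[of b c] by blast
  with min[of ?m] show ?thesis by simp
qed

text \<open>Growth is applied twice, for \<open>z\<close> from \<open>b\<close> to \<open>c\<close>
  and for \<open>w\<close> from \<open>c\<close> to \<open>b\<close>. In the sum the values of
  \<open>L\<close> cancel, leaving the inner product of \<open>z - w\<close> and
  \<open>b - c\<close>, which Young's inequality splits.\<close>

lemma prox_lipschitz:
  assumes convex: "\<And>b c. L (\<lambda>k. (b k + c k) / 2) \<le> (L b + L c) / 2"
    and min: "\<And>d. prox_objective n L z b \<le> prox_objective n L z d"
    and min': "\<And>d. prox_objective n L w c \<le> prox_objective n L w d"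
  shows "(\<Sum>k<n. (b k - c k)\<^sup>2) \<le> 4 * (\<Sum>k<n. (z k - w k)\<^sup>2)"
proof -
  let ?D = "\<Sum>k<n. (b k - c k)\<^sup>2"
  have "?D = (\<Sum>k<n. (c k - b k)\<^sup>2)"
    by (intro sum.cong refl) (simp add: power2_commute)
  then have "?D / 2 \<le> prox_objective n L z c - prox_objective n L z b
      + prox_objective n L w b - prox_objective n L w c"
    using prox_growth[OF convex min, of c] prox_growth[OF convex min', of b] by simp
  also have "\<dots> = (\<Sum>k<n. (z k - w k) * (b k - c k))"
  proof -
    have "(\<Sum>k<n. (z k - w k) * (b k - c k)) = (\<Sum>k<n. (z k - c k)\<^sup>2) / 2 - (\<Sum>k<n. (z k - b k)\<^sup>2) / 2
        + (\<Sum>k<n. (w k - b k)\<^sup>2) / 2 - (\<Sum>k<n. (w k - c k)\<^sup>2) / 2"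
      unfolding sum_divide_distrib sum.distrib[symmetric] sum_subtractf[symmetric]
      by (intro sum.cong refl) (simp add: field_simps power2_eq_square)
    then show ?thesis by (simp add: prox_objective_def)
  qed
  also have "\<dots> \<le> (\<Sum>k<n. (z k - w k)\<^sup>2 + (b k - c k)\<^sup>2 / 4)"
  proof (rule sum_mono)
    fix k
    have "0 \<le> (z k - w k - (b k - c k) / 2)\<^sup>2" by simp
    then show "(z k - w k) * (b k - c k) \<le> (z k - w k)\<^sup>2 + (b k - c k)\<^sup>2 / 4"
      by (simp add: field_simps power2_eq_square)
  qed
  also have "\<dots> = (\<Sum>k<n. (z k - w k)\<^sup>2) + ?D / 4"
    by (simp add: sum.distrib sum_divide_distrib)
  finally show ?thesis by simp
qed

text \<open>The Lipschitz bound involves finitely many coordinates, so it is continuous for the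
  product topology and squeezes the increment of coordinate \<open>k\<close> to 0.\<close>

lemma prox_continuous:
  assumes convex: "\<And>b c. L (\<lambda>k. (b k + c k) / 2) \<le> (L b + L c) / 2"
    and min: "\<And>z d. prox_objective n L z (P z) \<le> prox_objective n L z d"
    and k: "k < n"
  shows "continuous_on UNIV (\<lambda>z. P z k)"
proof -
  have "isCont (\<lambda>z. P z k) z" for z :: "nat \<Rightarrow> real"
  proof -
    let ?B = "\<lambda>w. sqrt (4 * (\<Sum>k<n. (w k - z k)\<^sup>2))"
    have "continuous_on UNIV ?B"
      by (intro continuous_intros continuous_on_product_coordinates)
    then have "isCont ?B z"
      by (simp add: continuous_on_eq_continuous_at)
    then have "(?B \<longlongrightarrow> ?B z) (at z)"
      unfolding isCont_def .
    then have B: "(?B \<longlongrightarrow> 0) (at z)" by simp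
    have "\<bar>P w k - P z k\<bar> \<le> ?B w" for w
    proof -
      have "(P w k - P z k)\<^sup>2 \<le> (\<Sum>k<n. (P w k - P z k)\<^sup>2)"
        using k by (intro member_le_sum) auto
      also have "\<dots> \<le> 4 * (\<Sum>k<n. (w k - z k)\<^sup>2)"
        by (rule prox_lipschitz[OF convex min min])
      finally have "sqrt ((P w k - P z k)\<^sup>2) \<le> ?B w" by (rule real_sqrt_le_mono)
      then show ?thesis by simp
    qed
    then have "((\<lambda>w. P w k - P z k) \<longlongrightarrow> 0) (at z)"
      by (intro Lim_null_comparison[OF _ B]) (auto intro: always_eventually)
    then show ?thesis
      unfolding isCont_def by (simp add: LIM_zero_iff)
  qed
  then show ?thesis by (simp add: continuous_on_eq_continuous_at)
qed

subsection \<open>The generalized lasso\<close>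

lemma l2_norm_square: "(l2_norm x)\<^sup>2 = (\<Sum>k<dim_vec x. (x $ k)\<^sup>2)"
  by (simp add: l2_norm_def scalar_prod_def power2_eq_square lessThan_atLeast0 sum_nonneg)

lemma mult_mat_vec_index:
  assumes "A \<in> carrier_mat r n" "x \<in> carrier_vec n" "j < r"
  shows "(A *\<^sub>v x) $ j = (\<Sum>k<n. A $$ (j, k) * x $ k)"
  using assms by (auto simp: scalar_prod_def lessThan_atLeast0 intro!: sum.cong)

lemma l1_norm_mult_mat_vec:
  assumes "A \<in> carrier_mat r n" "x \<in> carrier_vec n"
  shows "l1_norm (A *\<^sub>v x) = (\<Sum>j<r. \<bar>\<Sum>k<n. A $$ (j, k) * x $ k\<bar>)"
  unfolding l1_norm_def using assms
  by (intro sum.cong) (auto simp: mult_mat_vec_index[OF assms] simp del: index_mult_mat_vec)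

lemma orthonormal_systemD:
  assumes "orthonormal_system d I u" "i \<in> I" "i' \<in> I"
  shows "(\<Sum>k<d. u i $ k * u i' $ k) = (if i = i' then 1 else 0)"
proof -
  have "u i \<bullet> u i' = (if i = i' then 1 else 0)" "dim_vec (u i') = d"
    using assms by (auto simp: orthonormal_system_def)
  then show ?thesis by (simp add: scalar_prod_def lessThan_atLeast0)
qed

text \<open>The transpose of \<open>A\<close> sends \<open>u i\<close> to \<open>\<xi> i\<close>
  times \<open>v i\<close>, by orthonormality of the left singular vectors. Pairing with
  \<open>d\<close> and dividing by the positive \<open>\<xi> i\<close> gives the identity.\<close>

lemma compact_svd_adjoint:
  assumes A: "A \<in> carrier_mat r n" and svd: "compact_svd A u \<xi> v" and i: "i \<in> {1..mat_rank A}"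
  shows "(\<Sum>k<n. v i $ k * d k) = (\<Sum>j<r. u i $ j * (\<Sum>k<n. A $$ (j, k) * d k)) / \<xi> i"
proof -
  let ?Q = "{1..mat_rank A}"
  have dims: "dim_row A = r" "dim_col A = n" using A by auto
  have orth: "orthonormal_system r ?Q u" and pos: "\<forall>i\<in>?Q. 0 < \<xi> i"
    and A_eq: "A = mat r n (\<lambda>(j, k). \<Sum>i\<in>?Q. \<xi> i * (u i $ j) * (v i $ k))"
    using svd unfolding compact_svd_def dims by blast+
  have entry: "A $$ (j, k) = (\<Sum>i\<in>?Q. \<xi> i * (u i $ j) * (v i $ k))" if "j < r" "k < n" for j k
    using arg_cong[OF A_eq, of "\<lambda>B. B $$ (j, k)"] that by simp
  have "(\<Sum>j<r. u i $ j * A $$ (j, k)) = \<xi> i * v i $ k" if k: "k < n" for k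
  proof -
    have "(\<Sum>j<r. u i $ j * A $$ (j, k)) = (\<Sum>j<r. \<Sum>i'\<in>?Q. (\<xi> i' * v i' $ k) * (u i $ j * u i' $ j))"
      using k by (intro sum.cong refl) (simp add: entry sum_distrib_left mult_ac)
    also have "\<dots> = (\<Sum>i'\<in>?Q. (\<xi> i' * v i' $ k) * (\<Sum>j<r. u i $ j * u i' $ j))"
      by (subst sum.swap) (simp only: sum_distrib_left)
    also have "\<dots> = (\<Sum>i'\<in>?Q. (\<xi> i' * v i' $ k) * (if i = i' then 1 else 0))"
      using orthonormal_systemD[OF orth i] by (intro sum.cong refl) simp
    also have "\<dots> = \<xi> i * v i $ k"
      using i by (simp add: if_distrib cong: if_cong)
    finally show ?thesis .
  qed
  then have "(\<Sum>k<n. (\<Sum>j<r. u i $ j * A $$ (j, k)) * d k) = \<xi> i * (\<Sum>k<n. v i $ k * d k)"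
    by (simp add: sum_distrib_left mult_ac)
  moreover have "(\<Sum>k<n. (\<Sum>j<r. u i $ j * A $$ (j, k)) * d k)
      = (\<Sum>j<r. u i $ j * (\<Sum>k<n. A $$ (j, k) * d k))"
    unfolding sum_distrib_right sum_distrib_left
    by (subst sum.swap) (simp only: mult.assoc)
  moreover have "\<xi> i \<noteq> 0" using pos i by force
  ultimately show ?thesis by (metis nonzero_mult_div_cancel_left)
qed

section \<open>Convexity of the penalty, attainment of the minimum and measurability of the
  estimate\<close>

definition lasso_penalty :: "nat \<Rightarrow> nat \<Rightarrow> real mat \<Rightarrow> real \<Rightarrow> (nat \<Rightarrow> real) \<Rightarrow> real" where
  "lasso_penalty r n A lam b = lam * (\<Sum>j<r. \<bar>\<Sum>k<n. A $$ (j, k) * b k\<bar>)"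

lemma lasso_penalty_convex:
  assumes "lam \<ge> 0"
  shows "lasso_penalty r n A lam (\<lambda>k. (b k + c k) / 2) \<le> (lasso_penalty r n A lam b + lasso_penalty r n A lam c) / 2"
proof -
  have "(\<Sum>j<r. \<bar>\<Sum>k<n. A $$ (j, k) * ((b k + c k) / 2)\<bar>)
      \<le> (\<Sum>j<r. (\<bar>\<Sum>k<n. A $$ (j, k) * b k\<bar> + \<bar>\<Sum>k<n. A $$ (j, k) * c k\<bar>) / 2)"
  proof (rule sum_mono)
    fix j
    have "(\<Sum>k<n. A $$ (j, k) * ((b k + c k) / 2))
        = ((\<Sum>k<n. A $$ (j, k) * b k) + (\<Sum>k<n. A $$ (j, k) * c k)) / 2"
      unfolding sum.distrib[symmetric] sum_divide_distrib
      by (intro sum.cong refl) (simp add: distrib_left)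
    then show "\<bar>\<Sum>k<n. A $$ (j, k) * ((b k + c k) / 2)\<bar>
        \<le> (\<bar>\<Sum>k<n. A $$ (j, k) * b k\<bar> + \<bar>\<Sum>k<n. A $$ (j, k) * c k\<bar>) / 2"
      by simp
  qed
  also have "\<dots> = ((\<Sum>j<r. \<bar>\<Sum>k<n. A $$ (j, k) * b k\<bar>) + (\<Sum>j<r. \<bar>\<Sum>k<n. A $$ (j, k) * c k\<bar>)) / 2"
    unfolding sum.distrib[symmetric] sum_divide_distrib ..
  finally show ?thesis
    using mult_left_mono[OF _ assms] unfolding lasso_penalty_def
    by (fastforce simp: distrib_left)
qed

lemma generalized_lasso_objective:
  assumes A: "A \<in> carrier_mat r n" and y: "y \<in> carrier_vec n" and b: "b \<in> carrier_vec n"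
  shows "1/2 * (l2_norm (y - b))\<^sup>2 + lam * l1_norm (A *\<^sub>v b)
    = prox_objective n (lasso_penalty r n A lam) (\<lambda>k. y $ k) (\<lambda>k. b $ k)"
  using y b by (simp add: prox_objective_def lasso_penalty_def l2_norm_square l1_norm_mult_mat_vec[OF A b])

text \<open>\<open>ARG_MIN\<close> is a Hilbert choice and returns a minimizer only once one is
  known to exist. Existence comes from \<open>prox_exists\<close>, carried back to vectors by
  truncation with \<open>vec n\<close>.\<close>

lemma generalized_lasso_minimizes:
  assumes A: "A \<in> carrier_mat r n" and lam: "lam \<ge> 0" and y: "y \<in> carrier_vec n"
  shows "generalized_lasso A lam y \<in> carrier_vec n"
    and "prox_objective n (lasso_penalty r n A lam) (\<lambda>k. y $ k) (\<lambda>k. generalized_lasso A lam y $ k)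
      \<le> prox_objective n (lasso_penalty r n A lam) (\<lambda>k. y $ k) c"
proof -
  let ?f = "\<lambda>b. 1/2 * (l2_norm (y - b))\<^sup>2 + lam * l1_norm (A *\<^sub>v b)"
  let ?P = "\<lambda>b. b \<in> carrier_vec (dim_col A)"
  let ?F = "prox_objective n (lasso_penalty r n A lam) (\<lambda>k. y $ k)"
  have n: "dim_col A = n" using A by simp
  have cut: "?F (\<lambda>k. vec n b $ k) = ?F b" for b
    by (simp add: prox_objective_def lasso_penalty_def)
  have f: "?f b = ?F (\<lambda>k. b $ k)" if "b \<in> carrier_vec n" for b
    by (rule generalized_lasso_objective[OF A y that])
  have "\<exists>b. \<forall>c. ?F b \<le> ?F c"
  proof (rule prox_exists)
    show "continuous_on UNIV (lasso_penalty r n A lam)"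
      unfolding lasso_penalty_def
      by (intro continuous_intros continuous_on_product_coordinates)
    show "lasso_penalty r n A lam b \<ge> 0" for b
      using lam by (simp add: lasso_penalty_def sum_nonneg)
  qed (simp add: lasso_penalty_def)
  then obtain b where b: "\<And>c. ?F b \<le> ?F c" by blast
  have fb: "?f (vec n b) = ?F b"
    by (simp only: f[OF vec_carrier] cut)
  have "?P (vec n b) \<and> (\<forall>c. ?P c \<longrightarrow> ?f (vec n b) \<le> ?f c)"
    unfolding n fb using b f by (metis vec_carrier)
  then have "is_arg_min ?f ?P (vec n b)"
    by (auto simp: is_arg_min_def not_less)
  then have arg: "is_arg_min ?f ?P (generalized_lasso A lam y)"
    unfolding generalized_lasso_def arg_min_def by (rule someI)
  then show G: "generalized_lasso A lam y \<in> carrier_vec n"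
    by (simp add: is_arg_min_def n)
  have "?f (generalized_lasso A lam y) \<le> ?f (vec n b)"
    using arg by (auto simp: is_arg_min_def not_less n)
  also have "\<dots> = ?F b" by (rule fb)
  also have "\<dots> \<le> ?F c" by (rule b)
  finally show "?F (\<lambda>k. generalized_lasso A lam y $ k) \<le> ?F c"
    by (simp only: f[OF G])
qed

text \<open>The estimate factors through the continuous map \<open>P\<close> applied to the
  coordinate functions of \<open>y\<close>.\<close>

lemma generalized_lasso_measurable:
  assumes A: "A \<in> carrier_mat r n" and lam: "lam \<ge> 0"
    and y: "\<And>\<omega>. \<omega> \<in> space M \<Longrightarrow> y \<omega> \<in> carrier_vec n"
    and meas: "\<And>k. k < n \<Longrightarrow> (\<lambda>\<omega>. y \<omega> $ k) \<in> borel_measurable M"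
    and k: "k < n"
  shows "(\<lambda>\<omega>. generalized_lasso A lam (y \<omega>) $ k) \<in> borel_measurable M"
proof -
  let ?L = "lasso_penalty r n A lam"
  define P where "P z = (\<lambda>k. generalized_lasso A lam (vec n z) $ k)" for z :: "nat \<Rightarrow> real"
  \<comment> \<open>Measurability is given for the coordinates below \<open>n\<close> only; padding
    with 0 makes every coordinate of the product measurable.\<close>
  define Y where "Y \<omega> = (\<lambda>k. if k < n then y \<omega> $ k else 0)" for \<omega>
  have "prox_objective n ?L z b = prox_objective n ?L (\<lambda>k. vec n z $ k) b" for z b
    by (simp add: prox_objective_def)
  then have "prox_objective n ?L z (P z) \<le> prox_objective n ?L z d" for z d
    using generalized_lasso_minimizes(2)[OF A lam, of "vec n z" d] by (simp only: P_def vec_carrier)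
  then have "continuous_on UNIV (\<lambda>z. P z k)"
    using lasso_penalty_convex[OF lam] k by (intro prox_continuous)
  then have "(\<lambda>z. P z k) \<in> borel_measurable borel"
    by (rule borel_measurable_continuous_onI)
  moreover have "Y \<in> borel_measurable M"
  proof (rule measurable_coordinatewise_then_product)
    show "(\<lambda>\<omega>. Y \<omega> k) \<in> borel_measurable M" for k
      using meas by (cases "k < n") (auto simp: Y_def)
  qed
  ultimately have "(\<lambda>\<omega>. P (Y \<omega>) k) \<in> borel_measurable M"
    by (rule measurable_compose_rev)
  moreover have "vec n (Y \<omega>) = y \<omega>" if "\<omega> \<in> space M" for \<omega>
    using y[OF that] by (intro eq_vecI) (auto simp: Y_def)
  ultimately show ?thesis
    by (subst measurable_cong[where g="\<lambda>\<omega>. P (Y \<omega>) k"]) (auto simp: P_def)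
qed

section \<open>Centred noise and consequences of incoherence\<close>

lemma isotropic_gaussianD:
  assumes "isotropic_gaussian M n y \<beta>0 \<sigma>" and "\<sigma> > 0"
  shows "gaussian_noise M n \<sigma> (\<lambda>k \<omega>. y \<omega> $ k - \<beta>0 $ k)"
proof -
  interpret prob_space M using assms by (simp add: isotropic_gaussian_def)
  have D: "distributed M lborel (\<lambda>\<omega>. y \<omega> $ k) (normal_density (\<beta>0 $ k) \<sigma>)" if "k < n" for k
    using assms that by (auto simp: isotropic_gaussian_def)
  show ?thesis
  proof
    show "indep_vars (\<lambda>_. borel) (\<lambda>k \<omega>. y \<omega> $ k - \<beta>0 $ k) {..<n}"
      by (rule indep_vars_compose2[where Y="\<lambda>k x. x - \<beta>0 $ k" and M'="\<lambda>_. borel"])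
         (use assms(1) in \<open>simp_all add: isotropic_gaussian_def\<close>)
    show "distributed M lborel (\<lambda>\<omega>. y \<omega> $ k - \<beta>0 $ k) (normal_density 0 \<sigma>)" if "k < n" for k
      using normal_density_affine[OF D[OF that] assms(2), of 1 "- \<beta>0 $ k"] by simp
  qed (fact assms(2))
qed

lemma entry_square_le_linf_norm:
  assumes "linf_norm x \<le> b" "j < dim_vec x"
  shows "(x $ j)\<^sup>2 \<le> b\<^sup>2"
proof -
  have "\<bar>x $ j\<bar> \<le> linf_norm x"
    unfolding linf_norm_def using assms(2) by (intro Max_ge) auto
  then have "\<bar>x $ j\<bar>\<^sup>2 \<le> b\<^sup>2" using assms(1) by (intro power_mono) auto
  then show ?thesis by simp
qed

text \<open>A unit vector with \<open>r\<close> entries, each of square at most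
  \<open>\<mu>\<^sup>2 / n\<close>, forces \<open>1 \<le> r * \<mu>\<^sup>2 / n\<close>. Hence
  \<open>r\<close> tends to infinity with \<open>n\<close>.\<close>

lemma incoherent_dim_ge:
  assumes u: "orthonormal_system r I u" "i \<in> I" and inc: "linf_norm (u i) \<le> \<mu> / sqrt (real n)" and n: "n \<ge> 1"
  shows "real n \<le> \<mu>\<^sup>2 * real r"
proof -
  have dim: "dim_vec (u i) = r" using u by (auto simp: orthonormal_system_def)
  have "1 = (\<Sum>j<r. (u i $ j)\<^sup>2)"
    using orthonormal_systemD[OF u(1) u(2) u(2)] by (simp add: power2_eq_square)
  also have "\<dots> \<le> (\<Sum>j<r. (\<mu> / sqrt (real n))\<^sup>2)"
    using entry_square_le_linf_norm[OF inc] dim by (intro sum_mono) auto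
  also have "\<dots> = \<mu>\<^sup>2 * real r / real n"
    by (simp add: power_divide)
  finally show ?thesis using n by (simp add: field_simps)
qed

text \<open>The condition \<open>r \<ge> 1\<close> makes the logarithm nonnegative, so squaring
  undoes the square root.\<close>

lemma incoherence_rate_square:
  assumes A: "A \<in> carrier_mat r n" and r: "r \<ge> 1"
  shows "(incoherence_rate \<mu> A \<xi> i0)\<^sup>2 = \<mu>\<^sup>2 * (ln (real r) / real n * (\<Sum>i=i0+1..mat_rank A. 1 / (\<xi> i)\<^sup>2))"
  using A r by (simp add: incoherence_rate_def power_mult_distrib sum_nonneg)

lemma incoherence_rate_nonneg:
  assumes "A \<in> carrier_mat r n" "r \<ge> 1" "\<mu> \<ge> 0"
  shows "incoherence_rate \<mu> A \<xi> i0 \<ge> 0"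
  using assms by (simp add: incoherence_rate_def sum_nonneg)

text \<open>The vectors bounded here are the columns of the pseudo-inverse of \<open>A\<close>, truncated to the singular
  directions above \<open>i0\<close>.\<close>

lemma incoherent_pseudo_inverse_row:
  assumes A: "A \<in> carrier_mat r n" and svd: "compact_svd A u \<xi> v"
    and inc: "\<And>i. i \<in> {1..mat_rank A} \<Longrightarrow> linf_norm (u i) \<le> \<mu> / sqrt (real n)"
    and j: "j < r"
  shows "(\<Sum>k<n. (\<Sum>i\<in>{i0+1..mat_rank A}. u i $ j / \<xi> i * v i $ k)\<^sup>2)
    \<le> \<mu>\<^sup>2 / real n * (\<Sum>i=i0+1..mat_rank A. 1 / (\<xi> i)\<^sup>2)"
proof -
  let ?I = "{i0+1..mat_rank A}" and ?Q = "{1..mat_rank A}"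
  have sub: "?I \<subseteq> ?Q" by auto
  have ou: "orthonormal_system r ?Q u" and ov: "orthonormal_system n ?Q v"
    using svd A by (simp_all add: compact_svd_def)
  have "(\<Sum>k<n. (\<Sum>i\<in>?I. u i $ j / \<xi> i * v i $ k)\<^sup>2) = (\<Sum>i\<in>?I. (u i $ j / \<xi> i)\<^sup>2)"
    using orthonormal_systemD[OF ov] sub by (intro orthonormal_combination_square_sum) auto
  also have "\<dots> \<le> (\<Sum>i\<in>?I. \<mu>\<^sup>2 / real n * (1 / (\<xi> i)\<^sup>2))"
  proof (rule sum_mono)
    fix i assume i: "i \<in> ?I"
    then have "dim_vec (u i) = r" using ou sub by (auto simp: orthonormal_system_def)
    then have "(u i $ j)\<^sup>2 \<le> (\<mu> / sqrt (real n))\<^sup>2"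
      using entry_square_le_linf_norm[OF inc] i sub j by auto
    then have "(u i $ j)\<^sup>2 \<le> \<mu>\<^sup>2 / real n" by (simp add: power_divide)
    from divide_right_mono[OF this, of "(\<xi> i)\<^sup>2"]
    show "(u i $ j / \<xi> i)\<^sup>2 \<le> \<mu>\<^sup>2 / real n * (1 / (\<xi> i)\<^sup>2)"
      by (simp add: power_divide)
  qed
  finally show ?thesis by (simp add: sum_distrib_left)
qed

subsection \<open>Error of the generalized lasso\<close>

lemma lasso_noise_dominated:
  fixes A :: "real mat"
  assumes noise: "gaussian_noise M n \<sigma> e"
    and A: "A \<in> carrier_mat r n" and svd: "compact_svd A u \<xi> v" and r: "r \<ge> 1"
    and inc: "\<And>i. i \<in> {1..mat_rank A} \<Longrightarrow> linf_norm (u i) \<le> \<mu> / sqrt (real n)"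
    and \<mu>: "\<mu> > 0" and n: "n \<ge> 1"
    and lam: "lam \<ge> 2 * \<sigma> * incoherence_rate \<mu> A \<xi> i0"
  shows "measure M {\<omega> \<in> space M. \<exists>j<r. lam < \<bar>\<Sum>k<n. (\<Sum>i\<in>{i0+1..mat_rank A}. u i $ j / \<xi> i * v i $ k) * e k \<omega>\<bar>}
    \<le> 2 / real r"
proof -
  interpret gaussian_noise M n \<sigma> e by (rule noise)
  let ?I = "{i0+1..mat_rank A}" and ?rate = "incoherence_rate \<mu> A \<xi> i0"
  define S where "S = (\<Sum>i\<in>?I. 1 / (\<xi> i)\<^sup>2)"
  have rate: "?rate \<ge> 0" using \<mu> by (intro incoherence_rate_nonneg[OF A r]) simp
  have lam0: "lam \<ge> 0"
    using rate sigma_pos by (intro order_trans[OF _ lam] mult_nonneg_nonneg) auto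
  show ?thesis
  \<comment> \<open>If \<open>i0\<close> is at least the rank, all the forms vanish and the variance
    bound would be 0, which could not be divided by.\<close>
  proof (cases "?I = {}")
    case True
    with lam0 show ?thesis by (simp only: True sum.empty) simp
  next
    case False
    have pos: "0 < \<xi> i" if "i \<in> ?I" for i
      using svd that by (simp add: compact_svd_def)
    have S: "S > 0"
      unfolding S_def
    proof (rule sum_pos)
      fix i assume "i \<in> ?I"
      from pos[OF this] show "0 < 1 / (\<xi> i)\<^sup>2" by simp
    qed (use False in auto)
    define s where "s = sqrt (\<sigma>\<^sup>2 * (\<mu>\<^sup>2 / real n * S))"
    have s2: "s\<^sup>2 = \<sigma>\<^sup>2 * (\<mu>\<^sup>2 / real n * S)"
      unfolding s_def using S by simp
    have s2_pos: "s\<^sup>2 > 0"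
      unfolding s2 using S sigma_pos \<mu> n by simp
    \<comment> \<open>The factor 2 yields the exponent \<open>2 * ln r\<close>: one
      \<open>ln r\<close> pays for the union bound over \<open>r\<close> forms, the other leaves the
      probability \<open>2 / r\<close>.\<close>
    have "(2 * \<sigma> * ?rate)\<^sup>2 = 4 * ln (real r) * s\<^sup>2"
      by (simp add: power_mult_distrib incoherence_rate_square[OF A r] s2 S_def)
    moreover have "(2 * \<sigma> * ?rate)\<^sup>2 \<le> lam\<^sup>2"
      using lam rate sigma_pos by (intro power_mono) auto
    ultimately have lam2: "2 * ln (real r) \<le> lam\<^sup>2 / (2 * s\<^sup>2)"
      using s2_pos by (simp add: field_simps)
    have "prob {\<omega> \<in> space M. \<exists>j<r. lam < \<bar>\<Sum>k<n. (\<Sum>i\<in>?I. u i $ j / \<xi> i * v i $ k) * e k \<omega>\<bar>}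
        \<le> 2 * real r * exp (- lam\<^sup>2 / (2 * s\<^sup>2))"
    proof (rule linear_forms_max_tail[OF _ lam0])
      fix j assume "j < r"
      then show "\<sigma>\<^sup>2 * (\<Sum>k<n. (\<Sum>i\<in>?I. u i $ j / \<xi> i * v i $ k)\<^sup>2) \<le> s\<^sup>2"
        unfolding s2 S_def
        by (intro mult_left_mono incoherent_pseudo_inverse_row[OF A svd inc]) auto
    qed
    also have "\<dots> \<le> 2 * real r * exp (- (2 * ln (real r)))"
      using lam2 by (intro mult_left_mono) auto
    also have "exp (- (2 * ln (real r))) = 1 / (real r)\<^sup>2"
    proof -
      have "exp (2 * ln (real r)) = (real r)\<^sup>2"
        using r by (simp add: exp_double)
      then show ?thesis by (simp add: exp_minus field_simps)
    qed
    also have "2 * real r * (1 / (real r)\<^sup>2) = 2 / real r"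
      using r by (simp add: power2_eq_square)
    finally show ?thesis .
  qed
qed

text \<open>There are two bad events: \<open>T\<close>, where the unprojected noise reaches
  \<open>t\<close> times its mean, controlled by Markov, and \<open>N\<close>, where some form
  exceeds \<open>lam\<close>. Outside both, \<open>basic_inequality\<close> applies.\<close>

lemma generalized_lasso_error_tail:
  fixes A :: "real mat"
  assumes gauss: "isotropic_gaussian M n y \<beta>0 \<sigma>" and \<sigma>: "\<sigma> > 0" and n: "n \<ge> 1"
    and A: "A \<in> carrier_mat r n" and svd: "compact_svd A u \<xi> v" and r: "r \<ge> 1"
    and inc: "\<And>i. i \<in> {1..mat_rank A} \<Longrightarrow> linf_norm (u i) \<le> \<mu> / sqrt (real n)"
    and \<mu>: "\<mu> > 0" and i0: "i0 \<in> {1..mat_rank A}"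
    and lam: "lam \<ge> 2 * \<sigma> * incoherence_rate \<mu> A \<xi> i0" and t: "t > 0"
  shows "measure M {\<omega> \<in> space M. 4 * (t * (\<sigma>\<^sup>2 * (real (kernel_dim A) + real i0))) + 8 * lam * l1_norm (A *\<^sub>v \<beta>0)
      < (l2_norm (generalized_lasso A lam (y \<omega>) - \<beta>0))\<^sup>2} \<le> 1 / t + 2 / real r"
proof -
  define e where "e = (\<lambda>k \<omega>. y \<omega> $ k - \<beta>0 $ k)"
  have noise: "gaussian_noise M n \<sigma> e"
    unfolding e_def by (rule isotropic_gaussianD[OF gauss \<sigma>])
  interpret gaussian_noise M n \<sigma> e by (rule noise)
  let ?Q = "{1..mat_rank A}"
  define I where "I = {i0+1..mat_rank A}"
  have fin: "finite I" and sub: "I \<subseteq> ?Q" by (auto simp: I_def)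
  have y: "\<And>\<omega>. \<omega> \<in> space M \<Longrightarrow> y \<omega> \<in> carrier_vec n" and b0: "\<beta>0 \<in> carrier_vec n"
    using gauss by (auto simp: isotropic_gaussian_def)
  have lam0: "lam \<ge> 0"
    using lam \<sigma> \<mu> incoherence_rate_nonneg[OF A r, of \<mu> \<xi> i0]
    by (meson less_imp_le mult_nonneg_nonneg order_trans zero_le_numeral)
  have ov: "orthonormal_system n ?Q v"
    using svd A by (simp add: compact_svd_def)
  have orth: "(\<Sum>k<n. v i $ k * v i' $ k) = (if i = i' then 1 else 0)" if "i \<in> I" "i' \<in> I" for i i'
    by (rule orthonormal_systemD[OF ov subsetD[OF sub that(1)] subsetD[OF sub that(2)]])
  define R where "R = (\<lambda>\<omega>. \<Sum>k<n. (e k \<omega> - (\<Sum>i\<in>I. (\<Sum>l<n. v i $ l * e l \<omega>) * v i $ k))\<^sup>2)"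
  define m where "m = \<sigma>\<^sup>2 * (real (kernel_dim A) + real i0)"
  \<comment> \<open>Positivity comes from \<open>i0 \<ge> 1\<close>, even for trivial kernel; it
    allows division by \<open>m\<close> in Markov's inequality.\<close>
  have m: "m > 0" using \<sigma> i0 by (simp add: m_def)
  have R_int: "integrable M R"
    unfolding R_def by (rule residual_second_moment(1)[OF fin orth])
  have "expectation R = \<sigma>\<^sup>2 * (real n - real (card I))"
    unfolding R_def by (rule residual_second_moment(2)[OF fin orth])
  \<comment> \<open>\<open>I\<close> has rank minus \<open>i0\<close> elements, so rank-nullity
    leaves nullity plus \<open>i0\<close>.\<close>
  also have "real n - real (card I) = real (kernel_dim A) + real i0"
    using kernel_dim_plus_rank[OF A] i0 by (simp add: I_def)
  finally have ER: "expectation R = m" by (simp add: m_def)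
  define T where "T = {\<omega> \<in> space M. t * m \<le> R \<omega>}"
  define N where "N = {\<omega> \<in> space M. \<exists>j<r. lam < \<bar>\<Sum>k<n. (\<Sum>i\<in>I. u i $ j / \<xi> i * v i $ k) * e k \<omega>\<bar>}"
  have [measurable]: "R \<in> borel_measurable M" using R_int by simp
  have T_sets: "T \<in> sets M" unfolding T_def by measurable
  have N_sets: "N \<in> sets M" unfolding N_def by measurable
  have "prob T \<le> expectation R / (t * m)"
    unfolding T_def using t m
    by (intro integral_Markov_inequality_measure[where A="{}"] R_int) (auto simp: R_def sum_nonneg)
  then have T: "prob T \<le> 1 / t" using m by (simp add: ER)
  have N: "prob N \<le> 2 / real r"
    unfolding N_def I_def by (rule lasso_noise_dominated[OF noise A svd r inc \<mu> n lam])
  have "{\<omega> \<in> space M. 4 * (t * m) + 8 * lam * l1_norm (A *\<^sub>v \<beta>0)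
      < (l2_norm (generalized_lasso A lam (y \<omega>) - \<beta>0))\<^sup>2} \<subseteq> T \<union> N"
  proof (rule ccontr)
    assume "\<not> ?thesis"
    then obtain \<omega> where \<omega>: "\<omega> \<in> space M" "\<omega> \<notin> T" "\<omega> \<notin> N"
      and gt: "4 * (t * m) + 8 * lam * l1_norm (A *\<^sub>v \<beta>0) < (l2_norm (generalized_lasso A lam (y \<omega>) - \<beta>0))\<^sup>2"
      by auto
    define b where "b = generalized_lasso A lam (y \<omega>)"
    note min = generalized_lasso_minimizes[OF A lam0 y[OF \<omega>(1)], folded b_def]
    let ?D = "\<lambda>x j. \<Sum>k<n. A $$ (j, k) * x $ k"
    have "(\<Sum>k<n. (b $ k - \<beta>0 $ k)\<^sup>2)
        \<le> 4 * (\<Sum>k<n. (y \<omega> $ k - \<beta>0 $ k - (\<Sum>i\<in>I. (\<Sum>l<n. v i $ l * (y \<omega> $ l - \<beta>0 $ l)) * v i $ k))\<^sup>2)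
          + 8 * lam * (\<Sum>j<r. \<bar>?D \<beta>0 j\<bar>)"
    proof (rule basic_inequality[where u="\<lambda>i j. u i $ j" and \<xi>=\<xi> and Db="?D b"])
      show "(\<Sum>k<n. (y \<omega> $ k - b $ k)\<^sup>2) / 2 + lam * (\<Sum>j<r. \<bar>?D b j\<bar>)
          \<le> (\<Sum>k<n. (y \<omega> $ k - \<beta>0 $ k)\<^sup>2) / 2 + lam * (\<Sum>j<r. \<bar>?D \<beta>0 j\<bar>)"
        using min(2)[of "\<lambda>k. \<beta>0 $ k"] by (simp only: prox_objective_def lasso_penalty_def)
      show "(\<Sum>k<n. v i $ k * (b $ k - \<beta>0 $ k)) = (\<Sum>j<r. u i $ j * (?D b j - ?D \<beta>0 j)) / \<xi> i"
        if "i \<in> I" for i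
        using compact_svd_adjoint[OF A svd, of i "\<lambda>k. b $ k - \<beta>0 $ k"] that sub
        by (auto simp: right_diff_distrib sum_subtractf)
      show "\<bar>\<Sum>k<n. (\<Sum>i\<in>I. u i $ j / \<xi> i * v i $ k) * (y \<omega> $ k - \<beta>0 $ k)\<bar> \<le> lam" if "j < r" for j
        using \<omega>(1,3) that unfolding N_def e_def mem_Collect_eq by (meson not_less)
    qed (rule lam0)
    moreover have "(l2_norm (b - \<beta>0))\<^sup>2 = (\<Sum>k<n. (b $ k - \<beta>0 $ k)\<^sup>2)"
      using min(1) b0 by (simp add: l2_norm_square)
    ultimately have "(l2_norm (b - \<beta>0))\<^sup>2 \<le> 4 * R \<omega> + 8 * lam * l1_norm (A *\<^sub>v \<beta>0)"
      by (simp only: R_def e_def l1_norm_mult_mat_vec[OF A b0])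
    moreover have "R \<omega> < t * m" using \<omega>(1,2) by (simp add: T_def)
    ultimately show False using gt by (simp add: b_def)
  qed
  then have "prob {\<omega> \<in> space M. 4 * (t * m) + 8 * lam * l1_norm (A *\<^sub>v \<beta>0)
      < (l2_norm (generalized_lasso A lam (y \<omega>) - \<beta>0))\<^sup>2} \<le> prob (T \<union> N)"
    using T_sets N_sets by (intro finite_measure_mono) auto
  also have "\<dots> \<le> prob T + prob N"
    by (rule measure_Un_le[OF T_sets N_sets])
  also have "\<dots> \<le> 1 / t + 2 / real r" using T N by simp
  finally show ?thesis unfolding m_def .
qed

section \<open>From the tail bound to boundedness in probability\<close>

lemma generalized_lasso_error_measurable:
  assumes gauss: "isotropic_gaussian M n y \<beta>0 \<sigma>" and A: "A \<in> carrier_mat r n" and lam: "lam \<ge> 0"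
  shows "(\<lambda>\<omega>. (l2_norm (generalized_lasso A lam (y \<omega>) - \<beta>0))\<^sup>2) \<in> borel_measurable M"
proof -
  have y: "\<And>\<omega>. \<omega> \<in> space M \<Longrightarrow> y \<omega> \<in> carrier_vec n" and b0: "\<beta>0 \<in> carrier_vec n"
    and D: "\<And>k. k < n \<Longrightarrow> distributed M lborel (\<lambda>\<omega>. y \<omega> $ k) (normal_density (\<beta>0 $ k) \<sigma>)"
    using gauss by (auto simp: isotropic_gaussian_def)
  have "(\<lambda>\<omega>. y \<omega> $ k) \<in> borel_measurable M" if "k < n" for k
    using distributed_measurable[OF D[OF that]] by simp
  with y have "(\<lambda>\<omega>. generalized_lasso A lam (y \<omega>) $ k) \<in> borel_measurable M" if "k < n" for k
    using that by (intro generalized_lasso_measurable[OF A lam])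
  then have "(\<lambda>\<omega>. \<Sum>k<n. (generalized_lasso A lam (y \<omega>) $ k - \<beta>0 $ k)\<^sup>2) \<in> borel_measurable M"
    by (intro borel_measurable_sum) auto
  moreover have "(l2_norm (generalized_lasso A lam (y \<omega>) - \<beta>0))\<^sup>2
      = (\<Sum>k<n. (generalized_lasso A lam (y \<omega>) $ k - \<beta>0 $ k)\<^sup>2)" if "\<omega> \<in> space M" for \<omega>
    using generalized_lasso_minimizes(1)[OF A lam y[OF that]] b0 by (simp add: l2_norm_square)
  ultimately show ?thesis
    by (subst measurable_cong)
qed

text \<open>The two bounds on \<open>lam\<close> act separately: \<open>lower\<close> makes the
  penalty dominate the noise, while \<open>upper\<close> replaces \<open>lam\<close> by the rate in
  the resulting error bound.\<close>

lemma generalized_lasso_rate: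
  fixes \<sigma> \<mu> :: real and M :: "nat \<Rightarrow> 'a measure" and \<Delta> :: "nat \<Rightarrow> real mat"
  assumes \<sigma>: "\<sigma> > 0" and \<mu>: "\<mu> \<ge> 1"
    and gauss: "\<And>n. n \<ge> 1 \<Longrightarrow> isotropic_gaussian (M n) n (y n) (\<beta>0 n) \<sigma>"
    and D: "\<And>n. n \<ge> 1 \<Longrightarrow> \<Delta> n \<in> carrier_mat (r n) n"
    and svd: "\<And>n. n \<ge> 1 \<Longrightarrow> compact_svd (\<Delta> n) (u n) (\<xi> n) (v n)"
    and inc: "\<And>n i. n \<ge> 1 \<Longrightarrow> i \<in> {1..mat_rank (\<Delta> n)} \<Longrightarrow> linf_norm (u n i) \<le> \<mu> / sqrt (real n)"
    and i0: "\<And>n. n \<ge> 1 \<Longrightarrow> i0 n \<in> {1..mat_rank (\<Delta> n)}"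
    and upper: "lam \<in> O(\<lambda>n. incoherence_rate \<mu> (\<Delta> n) (\<xi> n) (i0 n))"
    and lower: "\<And>n. n \<ge> 1 \<Longrightarrow> lam n \<ge> 2 * \<sigma> * incoherence_rate \<mu> (\<Delta> n) (\<xi> n) (i0 n)"
  shows "bigo_in_prob M
    (\<lambda>n \<omega>. (l2_norm (generalized_lasso (\<Delta> n) (lam n) (y n \<omega>) - \<beta>0 n))\<^sup>2 / real n)
    (\<lambda>n. real (kernel_dim (\<Delta> n)) / real n + real (i0 n) / real n
      + incoherence_rate \<mu> (\<Delta> n) (\<xi> n) (i0 n) / real n * l1_norm (\<Delta> n *\<^sub>v \<beta>0 n))"
proof -
  let ?rate = "\<lambda>n. incoherence_rate \<mu> (\<Delta> n) (\<xi> n) (i0 n)"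
  let ?err = "\<lambda>n \<omega>. (l2_norm (generalized_lasso (\<Delta> n) (lam n) (y n \<omega>) - \<beta>0 n))\<^sup>2"
  let ?a = "\<lambda>n. real (kernel_dim (\<Delta> n)) / real n + real (i0 n) / real n + ?rate n / real n * l1_norm (\<Delta> n *\<^sub>v \<beta>0 n)"
  have r_ge: "real n \<le> \<mu>\<^sup>2 * real (r n)" if n: "n \<ge> 1" for n
  proof (rule incoherent_dim_ge[where u="u n" and i="i0 n" and \<mu>=\<mu>, OF _ i0[OF n] inc[OF n i0[OF n]] n])
    show "orthonormal_system (r n) {1..mat_rank (\<Delta> n)} (u n)"
      using svd[OF n] D[OF n] by (simp add: compact_svd_def)
  qed
  have r: "r n \<ge> 1" if "n \<ge> 1" for n
    using r_ge[OF that] that by (cases "r n = 0") auto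
  have rate: "?rate n \<ge> 0" if "n \<ge> 1" for n
    using incoherence_rate_nonneg[OF D[OF that] r[OF that]] \<mu> by simp
  have lam: "lam n \<ge> 0" if "n \<ge> 1" for n
    using lower[OF that] rate[OF that] \<sigma>
    by (meson less_imp_le mult_nonneg_nonneg order_trans zero_le_numeral)
  obtain C where C: "C > 0" "\<forall>\<^sub>F n in sequentially. norm (lam n) \<le> C * norm (?rate n)"
    using landau_o.bigE[OF upper] by blast
  have meas: "\<forall>\<^sub>F n in sequentially. (\<lambda>\<omega>. ?err n \<omega> / real n) \<in> borel_measurable (M n)"
    using eventually_ge_at_top[of 1]
  proof eventually_elim
    case (elim n)
    then show ?case
      by (intro borel_measurable_divide generalized_lasso_error_measurable[OF gauss D lam]) auto
  qed
  have "\<exists>K. \<forall>\<^sub>F n in sequentially.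
      measure (M n) {\<omega> \<in> space (M n). \<bar>?err n \<omega> / real n\<bar> > K * \<bar>?a n\<bar>} \<le> \<epsilon>" if \<epsilon>: "\<epsilon> > 0" for \<epsilon>
  proof -
    \<comment> \<open>Half of \<open>\<epsilon>\<close> goes to the Markov term
      \<open>1 / t\<close>, half to \<open>2 / r\<close>.\<close>
    define t where "t = 2 / \<epsilon>"
    \<comment> \<open>The first entry dominates the coefficient of nullity plus \<open>i0\<close>,
      the second that of the penalty term.\<close>
    define K where "K = max (4 * t * \<sigma>\<^sup>2) (8 * C)"
    have t: "t > 0" using \<epsilon> by (simp add: t_def)
    \<comment> \<open>With \<open>r_ge\<close> this threshold gives
      \<open>4 / \<epsilon> \<le> r\<close>, hence
      \<open>2 / r \<le> \<epsilon> / 2\<close>.\<close>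
    have "\<forall>\<^sub>F n in sequentially. 4 * \<mu>\<^sup>2 / \<epsilon> \<le> real n"
      by (rule filterlim_at_top[THEN iffD1, rule_format, OF filterlim_real_sequentially])
    with C(2) eventually_ge_at_top[of 1]
    have "\<forall>\<^sub>F n in sequentially.
      measure (M n) {\<omega> \<in> space (M n). \<bar>?err n \<omega> / real n\<bar> > K * \<bar>?a n\<bar>} \<le> \<epsilon>"
    proof eventually_elim
      case (elim n)
      note n = elim(2)
      define B where "B = l1_norm (\<Delta> n *\<^sub>v \<beta>0 n)"
      define d where "d = real (kernel_dim (\<Delta> n)) + real (i0 n)"
      have B: "B \<ge> 0" by (simp add: B_def l1_norm_def sum_nonneg)
      have d: "d \<ge> 0" by (simp add: d_def)
      interpret prob_space "M n" using gauss[OF n] by (simp add: isotropic_gaussian_def)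
      have "4 * (t * (\<sigma>\<^sup>2 * d)) \<le> K * d"
        using mult_right_mono[OF max.cobounded1 d, of "4 * t * \<sigma>\<^sup>2" "8 * C"] by (simp add: K_def mult.assoc)
      moreover have "8 * lam n * B \<le> K * (?rate n * B)"
      proof -
        have "lam n \<le> C * ?rate n" using elim(1) rate[OF n] lam[OF n] by simp
        then have "8 * lam n * B \<le> 8 * C * (?rate n * B)"
          using mult_right_mono[OF _ B] by fastforce
        also have "\<dots> \<le> K * (?rate n * B)"
          using rate[OF n] B by (intro mult_right_mono) (auto simp: K_def)
        finally show ?thesis .
      qed
      ultimately have bound: "4 * (t * (\<sigma>\<^sup>2 * d)) + 8 * lam n * B \<le> K * (d + ?rate n * B)"
        by (simp add: distrib_left)
      have a: "?a n = (d + ?rate n * B) / real n"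
        by (simp add: B_def d_def add_divide_distrib)
      have a0: "?a n \<ge> 0" unfolding a using d B rate[OF n] by simp
      have "{\<omega> \<in> space (M n). \<bar>?err n \<omega> / real n\<bar> > K * \<bar>?a n\<bar>}
          \<subseteq> {\<omega> \<in> space (M n). 4 * (t * (\<sigma>\<^sup>2 * d)) + 8 * lam n * B < ?err n \<omega>}"
      proof safe
        fix \<omega> assume "K * \<bar>?a n\<bar> < \<bar>?err n \<omega> / real n\<bar>"
        then have "K * ((d + ?rate n * B) / real n) < ?err n \<omega> / real n"
          using a0 by (simp only: abs_of_nonneg a) simp
        then have "K * (d + ?rate n * B) < ?err n \<omega>"
          using n by (simp add: divide_less_cancel)
        with bound show "4 * (t * (\<sigma>\<^sup>2 * d)) + 8 * lam n * B < ?err n \<omega>" by simp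
      qed
      \<comment> \<open>Monotonicity of the measure requires the larger event to be
        measurable.\<close>
      moreover have "{\<omega> \<in> space (M n). 4 * (t * (\<sigma>\<^sup>2 * d)) + 8 * lam n * B < ?err n \<omega>} \<in> sets (M n)"
        using generalized_lasso_error_measurable[OF gauss[OF n] D[OF n] lam[OF n]] by measurable
      ultimately have "prob {\<omega> \<in> space (M n). \<bar>?err n \<omega> / real n\<bar> > K * \<bar>?a n\<bar>}
          \<le> prob {\<omega> \<in> space (M n). 4 * (t * (\<sigma>\<^sup>2 * d)) + 8 * lam n * B < ?err n \<omega>}"
        by (rule finite_measure_mono)
      also have "\<dots> \<le> 1 / t + 2 / real (r n)"
        unfolding d_def B_def
        using generalized_lasso_error_tail[OF gauss[OF n] \<sigma> n D[OF n] svd[OF n] r[OF n] inc[OF n] _ i0[OF n] lower[OF n] t] \<mu>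
        by simp
      also have "2 / real (r n) \<le> \<epsilon> / 2"
      proof -
        have "4 * \<mu>\<^sup>2 / \<epsilon> \<le> \<mu>\<^sup>2 * real (r n)" using elim(3) r_ge[OF n] by simp
        then have "\<mu>\<^sup>2 * 4 \<le> \<mu>\<^sup>2 * (\<epsilon> * real (r n))" using \<epsilon> by (simp add: field_simps)
        then have "4 \<le> \<epsilon> * real (r n)" using \<mu> by (simp add: mult_le_cancel_left)
        then show ?thesis using r[OF n] by (simp add: field_simps)
      qed
      finally show ?case by (simp add: t_def)
    qed
    then show ?thesis by blast
  qed
  with meas show ?thesis unfolding bigo_in_prob_def by blast
qed


text \<open>The suitable constant in the order of \<open>lam\<close> is expressed as a threshold
  \<open>c\<close>, chosen before \<open>\<mu>\<close> and all the sequences;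
  \<open>2 * \<sigma>\<close> works because it is what the union bound over the noise forms
  demands.\<close>

theorem theorem6:
  fixes \<sigma> :: real
  assumes "\<sigma> > 0"
  shows "\<exists>c>0. \<forall>(\<mu>::real) (M :: nat \<Rightarrow> 'a measure) (y :: nat \<Rightarrow> 'a \<Rightarrow> real Matrix.vec)
           (\<beta>0 :: nat \<Rightarrow> real Matrix.vec) (r :: nat \<Rightarrow> nat) (\<Delta> :: nat \<Rightarrow> real mat)
           (u :: nat \<Rightarrow> nat \<Rightarrow> real Matrix.vec) (\<xi> :: nat \<Rightarrow> nat \<Rightarrow> real) (v :: nat \<Rightarrow> nat \<Rightarrow> real Matrix.vec)
           (i0 :: nat \<Rightarrow> nat) (lam :: nat \<Rightarrow> real).
         \<mu> \<ge> 1 \<longrightarrow>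
         (\<forall>n\<ge>1. isotropic_gaussian (M n) n (y n) (\<beta>0 n) \<sigma>) \<longrightarrow>
         (\<forall>n\<ge>1. \<Delta> n \<in> carrier_mat (r n) n) \<longrightarrow>
         (\<forall>n\<ge>1. compact_svd (\<Delta> n) (u n) (\<xi> n) (v n)) \<longrightarrow>
         (\<forall>n\<ge>1. \<forall>i\<in>{1..mat_rank (\<Delta> n)}. linf_norm (u n i) \<le> \<mu> / sqrt (real n)) \<longrightarrow>
         (\<forall>n\<ge>1. i0 n \<in> {1..mat_rank (\<Delta> n)}) \<longrightarrow>
         lam \<in> \<Theta>(\<lambda>n. incoherence_rate \<mu> (\<Delta> n) (\<xi> n) (i0 n)) \<longrightarrow>
         (\<forall>n\<ge>1. lam n \<ge> c * incoherence_rate \<mu> (\<Delta> n) (\<xi> n) (i0 n)) \<longrightarrow>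
         bigo_in_prob M
           (\<lambda>n \<omega>. (l2_norm (generalized_lasso (\<Delta> n) (lam n) (y n \<omega>) - \<beta>0 n))\<^sup>2 / real n)
           (\<lambda>n. real (kernel_dim (\<Delta> n)) / real n + real (i0 n) / real n
              + incoherence_rate \<mu> (\<Delta> n) (\<xi> n) (i0 n) / real n * l1_norm (\<Delta> n *\<^sub>v \<beta>0 n))"
proof (intro exI[of _ "2 * \<sigma>"] conjI allI impI)
  show "2 * \<sigma> > 0" using assms by simp
qed (rule generalized_lasso_rate[OF assms]; blast)

end
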